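(* Let $G$ be a countable group which admits a normal subgroup with two elements. Let $X$ be an infinite-dimensional separable real Banach space with a symmetric decomposition, such that either $X$ is isomorphic to $c_0(Y)$ or to $\ell_p(Y)$ for some Banach space $Y$ and some $1\leq p<+\infty$, or $X$ has the Radon-Nikodym Property. Then $G$ is representable in $X$.
   Context: A group $H$ is representable in a Banach space $X$ if there exists an equivalent norm on $X$ for which the group of isometries on $X$ (all surjective linear isometries of $X$ onto itself) is isomorphic, as a group, to $H$. Countable means finite or countably infinite. A Banach space $X$ has a symmetric decomposition if it is of the form $(\sum\oplus Y)_S$ for some Banach space $Y$ and some Banach space $S$ with a symmetric basis $(s_n)_{n\in\mathbb{N}}$ (an infinite basis), i.e. elements of $X$ are sequences $(y_n)_n$ in $Y$ with $\sum_n\|y_n\|s_n$ convergent in $S$, and the norm is $\|(y_n)_n\|=\|\sum_n\|y_n\|s_n\|$. $c_0(Y)$ and $\ell_p(Y)$ are the spaces of sequences in $Y$ whose sequence of norms is in $c_0$, resp. $\ell_p$, indexed by $\mathbb{N}$. *)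

theory Defs
  imports "HOL-Analysis.Analysis" "HOL-Algebra.Coset"
begin

text \<open>
  Equivalent norms, and the group of surjective linear isometries of the ambient real
  vector space for such a norm \<open>N\<close>.
\<close>

definition is_norm :: "('x::real_vector \<Rightarrow> real) \<Rightarrow> bool" where
  "is_norm N \<longleftrightarrow>
     (\<forall>x. 0 \<le> N x) \<and> (\<forall>x. N x = 0 \<longleftrightarrow> x = 0) \<and>
     (\<forall>a x. N (a *\<^sub>R x) = \<bar>a\<bar> * N x) \<and>
     (\<forall>x y. N (x + y) \<le> N x + N y)"

definition is_equivalent_norm :: "('x::real_normed_vector \<Rightarrow> real) \<Rightarrow> bool" where
  "is_equivalent_norm N \<longleftrightarrow>
     is_norm N \<and> (\<exists>c>0. \<exists>C>0. \<forall>x. c * norm x \<le> N x \<and> N x \<le> C * norm x)"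

definition isometry_group :: "('x::real_vector \<Rightarrow> real) \<Rightarrow> ('x \<Rightarrow> 'x) monoid" where
  "isometry_group N =
     \<lparr>carrier = {T. linear T \<and> surj T \<and> (\<forall>x. N (T x) = N x)},
      monoid.mult = (\<lambda>S T. S \<circ> T), one = id\<rparr>"

definition representable_in :: "('g, 'm) monoid_scheme \<Rightarrow> 'x::banach itself \<Rightarrow> bool" where
  "representable_in G _ \<longleftrightarrow>
     (\<exists>N :: 'x \<Rightarrow> real. is_equivalent_norm N \<and> isometry_group N \<cong> G)"

definition infinite_dimensional :: "'x::real_vector itself \<Rightarrow> bool" where
  "infinite_dimensional _ \<longleftrightarrow> \<not> (\<exists>B :: 'x set. finite B \<and> span B = UNIV)"

text \<open>
  A space of vector-valued sequences is given by its carrier \<open>E\<close> and its norm \<open>\<nu>\<close>,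
  which is meaningful on \<open>E\<close> only.
\<close>

definition isometric_to_seq_space ::
  "'x::real_normed_vector itself \<Rightarrow> (nat \<Rightarrow> 'y::real_normed_vector) set
     \<Rightarrow> ((nat \<Rightarrow> 'y) \<Rightarrow> real) \<Rightarrow> bool" where
  "isometric_to_seq_space _ E \<nu> \<longleftrightarrow>
     (\<exists>T :: 'x \<Rightarrow> nat \<Rightarrow> 'y. (\<forall>n. linear (\<lambda>x. T x n)) \<and> bij_betw T UNIV E \<and>
        (\<forall>x. \<nu> (T x) = norm x))"

definition isomorphic_to_seq_space ::
  "'x::real_normed_vector itself \<Rightarrow> (nat \<Rightarrow> 'y::real_normed_vector) set
     \<Rightarrow> ((nat \<Rightarrow> 'y) \<Rightarrow> real) \<Rightarrow> bool" where
  "isomorphic_to_seq_space _ E \<nu> \<longleftrightarrow>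
     (\<exists>T :: 'x \<Rightarrow> nat \<Rightarrow> 'y. (\<forall>n. linear (\<lambda>x. T x n)) \<and> bij_betw T UNIV E \<and>
        (\<exists>c>0. \<exists>C>0. \<forall>x. c * norm x \<le> \<nu> (T x) \<and> \<nu> (T x) \<le> C * norm x))"

definition c0_space :: "(nat \<Rightarrow> 'y::real_normed_vector) set" where
  "c0_space = {y. (\<lambda>n. norm (y n)) \<longlonglongrightarrow> 0}"

definition c0_norm :: "(nat \<Rightarrow> 'y::real_normed_vector) \<Rightarrow> real" where
  "c0_norm y = (SUP n. norm (y n))"

definition lp_space :: "real \<Rightarrow> (nat \<Rightarrow> 'y::real_normed_vector) set" where
  "lp_space p = {y. summable (\<lambda>n. norm (y n) powr p)}"

definition lp_norm :: "real \<Rightarrow> (nat \<Rightarrow> 'y::real_normed_vector) \<Rightarrow> real" where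
  "lp_norm p y = (\<Sum>n. norm (y n) powr p) powr (1 / p)"

definition schauder_basis :: "(nat \<Rightarrow> 's::real_normed_vector) \<Rightarrow> bool" where
  "schauder_basis s \<longleftrightarrow> (\<forall>x. \<exists>!a :: nat \<Rightarrow> real. (\<lambda>n. a n *\<^sub>R s n) sums x)"

text \<open>
  Symmetric in the sense of Lindenstrauss and Tzafriri: the basis is equivalent to each
  of its permutations. This entails unconditionality; no constant is required to be 1.
\<close>

definition equivalent_sequences ::
  "(nat \<Rightarrow> 's::real_normed_vector) \<Rightarrow> (nat \<Rightarrow> 't::real_normed_vector) \<Rightarrow> bool" where
  "equivalent_sequences s t \<longleftrightarrow>
     (\<forall>a :: nat \<Rightarrow> real. summable (\<lambda>n. a n *\<^sub>R s n) \<longleftrightarrow> summable (\<lambda>n. a n *\<^sub>R t n))"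

definition symmetric_basis :: "(nat \<Rightarrow> 's::real_normed_vector) \<Rightarrow> bool" where
  "symmetric_basis s \<longleftrightarrow>
     schauder_basis s \<and> (\<forall>\<pi>. bij \<pi> \<longrightarrow> equivalent_sequences s (s \<circ> \<pi>))"

definition sum_space ::
  "(nat \<Rightarrow> 's::real_normed_vector) \<Rightarrow> (nat \<Rightarrow> 'y::real_normed_vector) set" where
  "sum_space s = {y. summable (\<lambda>n. norm (y n) *\<^sub>R s n)}"

definition sum_norm ::
  "(nat \<Rightarrow> 's::real_normed_vector) \<Rightarrow> (nat \<Rightarrow> 'y::real_normed_vector) \<Rightarrow> real" where
  "sum_norm s y = norm (\<Sum>n. norm (y n) *\<^sub>R s n)"

text \<open>
  The Banach spaces \<open>Y\<close> and \<open>S\<close> are the types \<open>'y\<close> and \<open>'s\<close>. HOL cannot quantify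
  existentially over types, so they are parameters; as free type variables in a
  hypothesis they express ``for some \<open>Y\<close> and \<open>S\<close>''.
\<close>

definition symmetric_decomposition ::
  "'x::banach itself \<Rightarrow> 'y::banach itself \<Rightarrow> 's::banach itself \<Rightarrow> bool" where
  "symmetric_decomposition X _ _ \<longleftrightarrow>
     (\<exists>s :: nat \<Rightarrow> 's. symmetric_basis s \<and>
        isometric_to_seq_space X (sum_space s :: (nat \<Rightarrow> 'y) set) (sum_norm s))"

definition vector_measure :: "'w measure \<Rightarrow> ('w set \<Rightarrow> 'x::real_normed_vector) \<Rightarrow> bool" where
  "vector_measure M m \<longleftrightarrow>
     (\<forall>A :: nat \<Rightarrow> 'w set. range A \<subseteq> sets M \<longrightarrow> disjoint_family A \<longrightarrow>
        (\<lambda>n. m (A n)) sums m (\<Union>n. A n))"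

definition bounded_variation :: "'w measure \<Rightarrow> ('w set \<Rightarrow> 'x::real_normed_vector) \<Rightarrow> bool" where
  "bounded_variation M m \<longleftrightarrow>
     (\<exists>C :: real. \<forall>P. finite P \<and> P \<subseteq> sets M \<and> partition_on (space M) P \<longrightarrow>
        (\<Sum>A\<in>P. norm (m A)) \<le> C)"

text \<open>
  The integral below is the Bochner integral of the library, which is available for
  second countable (equivalently, separable) spaces only.
\<close>

definition rnp_wrt :: "'x::{banach, second_countable_topology} itself \<Rightarrow> 'w measure \<Rightarrow> bool" where
  "rnp_wrt _ M \<longleftrightarrow>
     (\<forall>m :: 'w set \<Rightarrow> 'x.
        vector_measure M m \<longrightarrow> bounded_variation M m \<longrightarrow> (\<forall>A\<in>null_sets M. m A = 0) \<longrightarrow>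
        (\<exists>f :: 'w \<Rightarrow> 'x. integrable M f \<and>
           (\<forall>A\<in>sets M. m A = (LINT w:A|M. f w))))"

text \<open>
  All finite measure spaces whose underlying set is a set of reals, with arbitrary
  sigma-algebras. A quantification over the type of points is not possible in HOL; the
  restriction does not change the notion, since the Radon-Nikodym property is determined
  by Lebesgue measure on the unit interval.
\<close>

definition radon_nikodym_property ::
  "'x::{banach, second_countable_topology} itself \<Rightarrow> bool" where
  "radon_nikodym_property X \<longleftrightarrow> (\<forall>M :: real measure. finite_measure M \<longrightarrow> rnp_wrt X M)"

end

theory Submission
  imports Defs
begin

text \<open>
  Let \<open>j\<close> be the nontrivial element of the normal subgroup; it is a central involution. The
  decomposition of the space \<open>X\<close> has infinitely many summands, which are copies of \<open>Y\<close>, and they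
  can be indexed by pairs of a coset of \<open>{1, j}\<close> and a natural number. On \<open>X\<close>, seen in this way as
  a space of odd functions on \<open>G \<times> nat\<close>, the group acts by translations, and \<open>j\<close> acts as minus the
  identity (\<open>signed_permutation_action\<close>). In coordinates these are signed permutations, and a
  gliding hump argument shows that all permutations of a symmetric basis are uniformly bounded
  (\<open>symmetric_basis_rearrangement\<close>). So the action is bounded and leaves an equivalent norm \<open>p\<close>
  invariant.

  It remains to destroy all other isometries. The new norm is the supremum of a round part and of
  the slabs \<open>\<bar>\<eta> k (g x)\<bar>\<close>, for \<open>g\<close> in \<open>G\<close> and a sequence of functionals
  \<open>\<eta> 0 = \<phi>\<close>, \<open>\<eta> (n + 1) = \<phi> + d n \<sigma> n\<close>. Here \<open>\<phi>\<close> comes from one coordinate, the \<open>\<sigma> n\<close> separate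
  points together with \<open>\<phi>\<close>, and the weights \<open>d n\<close> tend to zero very fast. The round part is
  nowhere linear. Hence the flat parts of the unit sphere, on which the norm coincides with a
  linear functional, come from slabs (\<open>flat_imp_eta\<close>), and each slab with \<open>k > 0\<close> does produce one
  (\<open>flat_eta_Suc\<close>). An isometry permutes the flat parts and so maps each \<open>\<eta> (n + 1)\<close> to some
  \<open>\<eta> k \<circ> g\<close>. Functionals belonging to different elements of \<open>G\<close> are far apart, while those
  belonging to the same element cluster at \<open>\<phi> \<circ> g\<close>. Thus \<open>g\<close> is the same for all \<open>n\<close>, and after
  division by \<open>g\<close> the isometry fixes the cluster point \<open>\<phi>\<close>. It also preserves the distances
  from \<open>\<phi>\<close>, which identify the functionals of the sequence, so it fixes all \<open>\<sigma> n\<close> and is the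
  identity (\<open>isometry_in_action\<close>).

  The suprema have to be attained for this. They are, because \<open>\<phi>\<close> and \<open>\<sigma> 0\<close> see one coordinate
  each, and the coordinates of a vector tend to zero. The sequence of functionals is obtained from
  the Hahn-Banach theorem and separability.
\<close>

section \<open>Linear functionals below sublinear ones\<close>

definition sublinear :: "('x::real_vector \<Rightarrow> real) \<Rightarrow> bool" where
  "sublinear q \<longleftrightarrow> (\<forall>x y. q (x + y) \<le> q x + q y) \<and> (\<forall>c\<ge>0. \<forall>x. q (c *\<^sub>R x) = c * q x)"

lemma sublinearI:
  assumes "\<And>x y. q (x + y) \<le> q x + q y" "q 0 = 0" "\<And>c x. c > 0 \<Longrightarrow> q (c *\<^sub>R x) \<le> c * q x"
  shows "sublinear q"
  unfolding sublinear_def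
proof (intro conjI allI impI)
  fix c :: real and x assume "c \<ge> 0"
  show "q (c *\<^sub>R x) = c * q x"
  proof (cases "c = 0")
    case False
    hence c: "c > 0" using \<open>c \<ge> 0\<close> by simp
    have "q (inverse c *\<^sub>R (c *\<^sub>R x)) \<le> inverse c * q (c *\<^sub>R x)" using c by (intro assms(3)) simp
    hence "c * q x \<le> q (c *\<^sub>R x)" using c by (simp add: field_simps)
    thus ?thesis using assms(3)[OF c, of x] by simp
  qed (use assms(2) in simp)
qed (use assms(1) in simp)

lemma sublinear_add: "sublinear q \<Longrightarrow> q (x + y) \<le> q x + q y"
  and sublinear_scale: "sublinear q \<Longrightarrow> c \<ge> 0 \<Longrightarrow> q (c *\<^sub>R x) = c * q x"
  by (auto simp: sublinear_def)

lemma sublinear_0: "sublinear q \<Longrightarrow> q 0 = 0"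
  using sublinear_scale[of q 0 0] by simp

lemma sublinear_lower: "sublinear q \<Longrightarrow> - q (- x) \<le> q x"
  using sublinear_add[of q x "- x"] sublinear_0[of q] by simp

text \<open>
  The infimum of \<open>q (x + t a) - t q a\<close> over \<open>t \<ge> 0\<close> is the largest sublinear functional below
  \<open>q\<close> that is at most \<open>- q a\<close> at \<open>- a\<close>. A linear functional below it is therefore forced to attain \<open>q\<close>
  at \<open>a\<close>. This one construction serves twice: it shows that a minimal sublinear functional is
  additive, and it selects norming functionals.
\<close>
lemma sublinear_tilt:
  assumes q: "sublinear q"
  shows "\<exists>r. sublinear r \<and> (\<forall>x. r x \<le> q x) \<and> (\<forall>x. r x \<le> q (x + a) - q a)"
proof -
  define f where "f x t = q (x + t *\<^sub>R a) - t * q a" for x t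
  define r where "r x = (INF t\<in>{0..}. f x t)" for x
  have low: "- q (- x) \<le> f x t" if "t \<ge> 0" for x t
    using sublinear_add[OF q, of "x + t *\<^sub>R a" "- x"] sublinear_scale[OF q that, of a] by (simp add: f_def)
  have le: "r x \<le> f x t" if "t \<ge> 0" for x t
    unfolding r_def using that low by (intro cINF_lower bdd_belowI2[of _ "- q (- x)"]) auto
  have greatest: "c \<le> r x" if "\<And>t. t \<ge> 0 \<Longrightarrow> c \<le> f x t" for c x
    unfolding r_def by (rule cINF_greatest) (use that in auto)
  have "sublinear r"
  proof (rule sublinearI)
    fix x y
    have *: "r (x + y) \<le> f x t + f y u" if "t \<ge> 0" "u \<ge> 0" for t u
    proof -
      have "r (x + y) \<le> f (x + y) (t + u)" using that by (intro le) simp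
      also have "\<dots> \<le> f x t + f y u"
        using sublinear_add[OF q, of "x + t *\<^sub>R a" "y + u *\<^sub>R a"] by (simp add: f_def algebra_simps)
      finally show ?thesis .
    qed
    have "r (x + y) - f x t \<le> r y" if "t \<ge> 0" for t
      by (rule greatest) (use *[OF that] in \<open>simp add: algebra_simps\<close>)
    hence "r (x + y) - r y \<le> r x" by (intro greatest) (simp add: algebra_simps)
    thus "r (x + y) \<le> r x + r y" by simp
  next
    have "0 \<le> r 0" by (rule greatest) (simp add: f_def sublinear_scale[OF q])
    moreover have "r 0 \<le> 0" using le[of 0 0] by (simp add: f_def sublinear_0[OF q])
    ultimately show "r 0 = 0" by simp
  next
    fix c :: real and x assume c: "c > 0"
    have "inverse c * r (c *\<^sub>R x) \<le> r x"
    proof (rule greatest)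
      fix t :: real assume t: "t \<ge> 0"
      have "r (c *\<^sub>R x) \<le> f (c *\<^sub>R x) (c * t)" using c t by (intro le) simp
      also have "\<dots> = q (c *\<^sub>R (x + t *\<^sub>R a)) - c * t * q a" by (simp add: f_def scaleR_add_right)
      also have "\<dots> = c * f x t" using sublinear_scale[OF q, of c "x + t *\<^sub>R a"] c by (simp add: f_def algebra_simps)
      finally show "inverse c * r (c *\<^sub>R x) \<le> f x t" using c by (simp add: field_simps)
    qed
    thus "r (c *\<^sub>R x) \<le> c * r x" using c by (simp add: field_simps)
  qed
  moreover have "r x \<le> q x" for x using le[of 0 x] by (simp add: f_def)
  moreover have "r x \<le> q (x + a) - q a" for x using le[of 1 x] by (simp add: f_def)
  ultimately show ?thesis by blast
qed

text \<open>
  The Hahn-Banach theorem in the form of a minimality principle. Below \<open>p\<close> there is a minimal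
  sublinear functional, since the pointwise infimum of a chain is again sublinear. Tilting a
  minimal functional \<open>m\<close> in the direction \<open>a\<close> cannot lower it, and this says
  \<open>m x + m a \<le> m (x + a)\<close>.
\<close>
theorem sublinear_dominates_linear:
  assumes p: "sublinear p"
  shows "\<exists>f. linear f \<and> (\<forall>x. f x \<le> p x)"
proof -
  define A where "A = {q. sublinear q \<and> q \<le> p}"
  have "\<exists>m\<in>A. \<forall>q\<in>A. q \<le> m \<longrightarrow> q = m"
  proof (rule predicate_Zorn)
    show "partial_order_on A (relation_of (\<lambda>m q. q \<le> m) A)"
      by (rule partial_order_on_relation_ofI) auto
  next
    fix C assume C: "C \<in> Chains (relation_of (\<lambda>m q. q \<le> m) A)"
    have CA: "q \<in> A" if "q \<in> C" for q using C that by (auto simp: Chains_def relation_of_def)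
    have chain: "q \<le> r \<or> r \<le> q" if "q \<in> C" "r \<in> C" for q r
      using C that by (auto simp: Chains_def relation_of_def)
    show "\<exists>u\<in>A. \<forall>q\<in>C. u \<le> q"
    proof (cases "C = {}")
      case True thus ?thesis using p by (auto simp: A_def)
    next
      case False
      define u where "u x = (INF q\<in>C. q x)" for x
      have low: "- p (- x) \<le> q x" if "q \<in> C" for q x
      proof -
        have "sublinear q" "q (- x) \<le> p (- x)" using CA[OF that] by (auto simp: A_def le_fun_def)
        thus ?thesis using sublinear_lower[of q x] by linarith
      qed
      have le: "u x \<le> q x" if "q \<in> C" for q x
        unfolding u_def using that low by (intro cINF_lower bdd_belowI2[of _ "- p (- x)"]) auto
      have greatest: "c \<le> u x" if "\<And>q. q \<in> C \<Longrightarrow> c \<le> q x" for c x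
        unfolding u_def by (rule cINF_greatest) (use that False in auto)
      have sub: "sublinear q" if "q \<in> C" for q using CA[OF that] by (simp add: A_def)
      have "sublinear u"
      proof (rule sublinearI)
        fix x y
        have *: "u (x + y) \<le> q x + r y" if q: "q \<in> C" and r: "r \<in> C" for q r
          using chain[OF q r]
        proof
          assume "q \<le> r"
          hence "q y \<le> r y" by (simp add: le_fun_def)
          thus ?thesis using le[OF q, of "x + y"] sublinear_add[OF sub[OF q], of x y] by linarith
        next
          assume "r \<le> q"
          hence "r x \<le> q x" by (simp add: le_fun_def)
          thus ?thesis using le[OF r, of "x + y"] sublinear_add[OF sub[OF r], of x y] by linarith
        qed
        have "u (x + y) - q x \<le> u y" if "q \<in> C" for q
          by (rule greatest) (use *[OF that] in \<open>simp add: algebra_simps\<close>)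
        hence "u (x + y) - u y \<le> u x" by (intro greatest) (simp add: algebra_simps)
        thus "u (x + y) \<le> u x + u y" by simp
      next
        obtain q where q: "q \<in> C" using False by blast
        have "0 \<le> u 0" by (rule greatest) (simp add: sublinear_0[OF sub])
        moreover have "u 0 \<le> 0" using le[OF q, of 0] by (simp add: sublinear_0[OF sub[OF q]])
        ultimately show "u 0 = 0" by simp
      next
        fix c :: real and x assume c: "c > 0"
        have "inverse c * u (c *\<^sub>R x) \<le> u x"
        proof (rule greatest)
          fix q assume q: "q \<in> C"
          show "inverse c * u (c *\<^sub>R x) \<le> q x"
            using le[OF q, of "c *\<^sub>R x"] c by (simp add: sublinear_scale[OF sub[OF q]] field_simps)
        qed
        thus "u (c *\<^sub>R x) \<le> c * u x" using c by (simp add: field_simps)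
      qed
      moreover have "u \<le> p"
      proof (rule le_funI)
        fix x
        obtain q where q: "q \<in> C" using False by blast
        have "q x \<le> p x" using CA[OF q] by (simp add: A_def le_fun_def)
        thus "u x \<le> p x" using le[OF q, of x] by linarith
      qed
      ultimately have "u \<in> A" by (simp add: A_def)
      thus ?thesis using le by (intro bexI[of _ u]) (auto simp: le_fun_def)
    qed
  qed
  then obtain m where m: "sublinear m" "m \<le> p" and min: "\<And>q. sublinear q \<Longrightarrow> q \<le> p \<Longrightarrow> q \<le> m \<Longrightarrow> q = m"
    by (auto simp: A_def)
  have add: "m (x + a) = m x + m a" for x a
  proof -
    obtain r where r: "sublinear r" "\<And>x. r x \<le> m x" "\<And>x. r x \<le> m (x + a) - m a"
      using sublinear_tilt[OF m(1), of a] by blast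
    have "r \<le> m" using r(2) by (simp add: le_fun_def)
    hence "r = m" using min[OF r(1)] m(2) order_trans by blast
    thus ?thesis using r(3)[of x] sublinear_add[OF m(1), of x a] by simp
  qed
  have minus: "m (- x) = - m x" for x using add[of x "- x"] sublinear_0[OF m(1)] by simp
  have "linear m"
  proof (rule linearI)
    fix c :: real and x
    show "m (c *\<^sub>R x) = c *\<^sub>R m x"
    proof (cases "c \<ge> 0")
      case True thus ?thesis by (simp add: sublinear_scale[OF m(1)])
    next
      case False
      hence "m ((- c) *\<^sub>R x) = (- c) * m x" by (intro sublinear_scale[OF m(1)]) simp
      thus ?thesis using minus[of "c *\<^sub>R x"] by simp
    qed
  qed (rule add)
  thus ?thesis using m(2) by (auto simp: le_fun_def)
qed

lemma norming_functional:
  fixes y :: "'x::real_normed_vector"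
  shows "\<exists>f. linear f \<and> (\<forall>x. \<bar>f x\<bar> \<le> norm x) \<and> f y = norm y"
proof -
  have "sublinear (norm :: 'x \<Rightarrow> real)" by (simp add: sublinear_def norm_triangle_ineq)
  then obtain r where r: "sublinear r" "\<And>x. r x \<le> norm x" "\<And>x. r x \<le> norm (x + y) - norm y"
    using sublinear_tilt[of norm y] by blast
  obtain f where f: "linear f" "\<And>x. f x \<le> r x" using sublinear_dominates_linear[OF r(1)] by blast
  have le: "f x \<le> norm x" for x using f(2)[of x] r(2)[of x] by linarith
  have minus: "f (- x) = - f x" for x using f(1) by (rule linear_neg)
  have "\<bar>f x\<bar> \<le> norm x" for x using le[of x] le[of "- x"] minus[of x] by simp
  moreover have "- f y \<le> - norm y" using f(2)[of "- y"] r(3)[of "- y"] minus[of y] by simp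
  hence "f y = norm y" using le[of y] by simp
  ultimately show ?thesis using f(1) by blast
qed

text \<open>
  Norming functionals of a dense sequence: a vector that all of them annihilate is close to a
  point of the sequence whose norm would have to be almost zero.
\<close>
lemma total_sequence_of_functionals:
  "\<exists>h :: nat \<Rightarrow> 'x::{real_normed_vector, second_countable_topology} \<Rightarrow> real.
     (\<forall>n. linear (h n)) \<and> (\<forall>n x. \<bar>h n x\<bar> \<le> norm x) \<and> (\<forall>x. (\<forall>n. h n x = 0) \<longrightarrow> x = 0)"
proof -
  obtain D :: "'x set" where D: "countable D" "\<And>X. open X \<Longrightarrow> X \<noteq> {} \<Longrightarrow> \<exists>d\<in>D. d \<in> X"
    using countable_dense_exists[where 'a = 'x] by blast
  obtain h where h: "\<And>y :: 'x. linear (h y)" "\<And>y x :: 'x. \<bar>h y x\<bar> \<le> norm x" "\<And>y :: 'x. h y y = norm y"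
    using norming_functional by metis
  have "D \<noteq> {}" using D(2)[of UNIV] by auto
  have "x = 0" if zero: "\<And>n. h (from_nat_into D n) x = 0" for x
  proof (rule ccontr)
    assume "x \<noteq> 0"
    then obtain y where y: "y \<in> D" "y \<in> ball x (norm x / 4)" using D(2)[of "ball x (norm x / 4)"] by auto
    obtain n where "y = from_nat_into D n" using y(1) D(1) by (metis from_nat_into_surj)
    hence "h y x = 0" using zero by simp
    hence "norm y = h y (y - x)" using h(1)[of y] h(3)[of y] by (simp add: linear_diff)
    also have "\<dots> \<le> norm (y - x)" using h(2)[of y "y - x"] by linarith
    also have "\<dots> < norm x / 4" using y(2) by (simp add: dist_norm norm_minus_commute)
    finally have 1: "norm y < norm x / 4" .
    have "norm x \<le> norm y + norm (x - y)" using norm_triangle_sub[of x y] by simp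
    thus False using 1 y(2) norm_ge_zero[of x] by (simp add: dist_norm)
  qed
  thus ?thesis
    by (intro exI[of _ "\<lambda>n. h (from_nat_into D n)"] conjI allI impI h) simp
qed

text \<open>
  A total sequence of functionals that vanish at \<open>z\<close> is thinned out to a triangular one, with
  vectors \<open>v n\<close> on which \<open>\<sigma> n\<close> is 1 while \<open>\<phi>\<close> and all earlier functionals vanish. The functionals
  that survive are those which do not vanish on the common kernel of their predecessors; the
  others vanish wherever all survivors vanish, so that totality is kept. Finitely many survivors
  would give a finite spanning set by elimination. The first functional is kept, up to scaling.
\<close>
lemma triangular_subsystem:
  fixes \<phi> :: "'x::real_vector \<Rightarrow> real" and \<tau> :: "nat \<Rightarrow> 'x \<Rightarrow> real"
  assumes inf: "infinite_dimensional TYPE('x)"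
    and phi: "linear \<phi>" "\<phi> z = 1"
    and tau: "\<And>n. linear (\<tau> n)" "\<And>n. \<tau> n z = 0" "\<tau> 0 w \<noteq> 0"
    and bound: "\<And>n. B n > 0" "\<And>n x. \<bar>\<tau> n x\<bar> \<le> B n * p x"
    and total: "\<And>x. \<phi> x = 0 \<Longrightarrow> (\<And>n. \<tau> n x = 0) \<Longrightarrow> x = 0"
  obtains \<sigma> :: "nat \<Rightarrow> 'x \<Rightarrow> real" and v
  where "\<And>n. linear (\<sigma> n)" "\<And>n x. \<bar>\<sigma> n x\<bar> \<le> p x" "\<And>n. \<sigma> n z = 0"
    "\<And>n. \<phi> (v n) = 0" "\<And>n. \<sigma> n (v n) = 1" "\<And>m n. m < n \<Longrightarrow> \<sigma> m (v n) = 0"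
    "\<And>x. \<phi> x = 0 \<Longrightarrow> (\<And>n. \<sigma> n x = 0) \<Longrightarrow> x = 0" "\<And>x. \<sigma> 0 x = \<tau> 0 x / B 0"
proof -
  define I where "I = {i. \<exists>v. (\<forall>l<i. \<tau> l v = 0) \<and> \<tau> i v \<noteq> 0}"
  have "\<exists>v. \<phi> v = 0 \<and> (\<forall>l<i. \<tau> l v = 0) \<and> \<tau> i v = 1" if i: "i \<in> I" for i
  proof -
    obtain v where v: "\<forall>l<i. \<tau> l v = 0" "\<tau> i v \<noteq> 0" using i by (auto simp: I_def)
    \<comment> \<open>Subtracting a multiple of \<open>z\<close> kills \<open>\<phi>\<close> and changes no \<open>\<tau> l\<close>.\<close>
    define v' where "v' = inverse (\<tau> i v) *\<^sub>R (v - \<phi> v *\<^sub>R z)"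
    have "\<tau> l v' = inverse (\<tau> i v) * \<tau> l v" for l
      using tau(1)[of l] tau(2)[of l] by (simp add: v'_def linear_scale linear_diff)
    moreover have "\<phi> v' = 0" using phi by (simp add: v'_def linear_scale linear_diff)
    ultimately show ?thesis using v by (intro exI[of _ v']) auto
  qed
  then obtain V where V: "\<And>i. i \<in> I \<Longrightarrow> \<phi> (V i) = 0" "\<And>i l. i \<in> I \<Longrightarrow> l < i \<Longrightarrow> \<tau> l (V i) = 0"
     "\<And>i. i \<in> I \<Longrightarrow> \<tau> i (V i) = 1" by metis
  have tau_I: "\<tau> n x = 0" if "\<And>i. i \<in> I \<Longrightarrow> \<tau> i x = 0" for n x
    using that by (induction n rule: less_induct) (auto simp: I_def)
  have infI: "infinite I"
  proof
    assume fin: "finite I"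
    define S where "S = insert z (V ` I)"
    have elim: "\<exists>y\<in>span S. \<phi> (x - y) = 0 \<and> (\<forall>i<M. i \<in> I \<longrightarrow> \<tau> i (x - y) = 0)" for x M
    proof (induction M)
      case 0
      have "\<phi> x *\<^sub>R z \<in> span S" by (intro span_scale span_base) (simp add: S_def)
      moreover have "\<phi> (x - \<phi> x *\<^sub>R z) = 0" using phi by (simp add: linear_diff linear_scale)
      ultimately show ?case by auto
    next
      case (Suc M)
      then obtain y where y: "y \<in> span S" "\<phi> (x - y) = 0" "\<And>i. i < M \<Longrightarrow> i \<in> I \<Longrightarrow> \<tau> i (x - y) = 0" by blast
      show ?case
      proof (cases "M \<in> I")
        case True
        define y' where "y' = y + \<tau> M (x - y) *\<^sub>R V M"
        have "y' \<in> span S" unfolding y'_def using y(1) True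
          by (intro span_add span_scale span_base[of "V M"]) (auto simp: S_def)
        moreover have eq: "x - y' = (x - y) - \<tau> M (x - y) *\<^sub>R V M" by (simp add: y'_def)
        moreover have "\<phi> (x - y') = 0" unfolding eq using phi(1) y(2) V(1)[OF True]
          by (simp add: linear_diff[of \<phi> "x - y"] linear_scale)
        moreover have "\<tau> i (x - y') = 0" if "i < Suc M" "i \<in> I" for i
        proof -
          have "\<tau> i (x - y') = \<tau> i (x - y) - \<tau> M (x - y) * \<tau> i (V M)"
            unfolding eq using tau(1)[of i] by (simp add: linear_diff[of "\<tau> i" "x - y"] linear_scale)
          thus ?thesis using that y(3)[of i] V(2)[OF True, of i] V(3)[OF True] by (cases "i = M") auto
        qed
        ultimately show ?thesis by blast
      next
        case False
        thus ?thesis using y by (intro bexI[of _ y]) (auto simp: less_Suc_eq)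
      qed
    qed
    have "x \<in> span S" for x
    proof -
      obtain M where M: "\<And>i. i \<in> I \<Longrightarrow> i < M" using fin finite_nat_set_iff_bounded by metis
      obtain y where y: "y \<in> span S" "\<phi> (x - y) = 0" "\<And>i. i < M \<Longrightarrow> i \<in> I \<Longrightarrow> \<tau> i (x - y) = 0"
        using elim[of x M] by blast
      have "x - y = 0" using y(2,3) M tau_I[of "x - y"] by (intro total) blast+
      thus ?thesis using y(1) by simp
    qed
    hence "span S = UNIV" by blast
    moreover have "finite S" using fin by (simp add: S_def)
    ultimately have "\<exists>B :: 'x set. finite B \<and> span B = UNIV" by (intro exI[of _ S]) simp
    with inf show False by (simp add: infinite_dimensional_def)
  qed
  define e where "e = enumerate I"
  have eI: "e n \<in> I" for n unfolding e_def by (rule enumerate_in_set[OF infI])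
  have e_less: "m < n \<Longrightarrow> e m < e n" for m n unfolding e_def by (rule enumerate_mono[OF _ infI])
  have "0 \<in> I" using tau(3) by (auto simp: I_def)
  hence e0: "e 0 = 0" unfolding e_def enumerate_0 by (rule Least_eq_0)
  show ?thesis
  proof (rule that[of "\<lambda>n x. \<tau> (e n) x / B (e n)" "\<lambda>n. B (e n) *\<^sub>R V (e n)"])
    have Bnz: "B n \<noteq> 0" for n using bound(1)[of n] by simp
    show "linear (\<lambda>x. \<tau> (e n) x / B (e n))" for n
      using tau(1)[of "e n"] by (auto intro!: linearI simp: linear_add linear_scale add_divide_distrib)
    show "\<bar>\<tau> (e n) x / B (e n)\<bar> \<le> p x" for n x
      using bound(2)[of "e n" x] bound(1)[of "e n"] by (simp add: abs_divide field_simps)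
    show "\<tau> (e n) z / B (e n) = 0" for n by (simp add: tau(2))
    show "\<phi> (B (e n) *\<^sub>R V (e n)) = 0" for n using phi(1) V(1)[OF eI] by (simp add: linear_scale)
    show "\<tau> (e n) (B (e n) *\<^sub>R V (e n)) / B (e n) = 1" for n
      using tau(1)[of "e n"] V(3)[OF eI, of n] Bnz by (simp add: linear_scale)
    show "\<tau> (e m) (B (e n) *\<^sub>R V (e n)) / B (e m) = 0" if "m < n" for m n
      using tau(1)[of "e m"] V(2)[OF eI e_less[OF that]] by (simp add: linear_scale)
    show "x = 0" if "\<phi> x = 0" "\<And>n. \<tau> (e n) x / B (e n) = 0" for x
    proof (rule total[OF that(1)])
      have "\<tau> i x = 0" if i: "i \<in> I" for i
      proof -
        obtain n where "e n = i" using enumerate_Ex[OF infI i] unfolding e_def by blast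
        thus ?thesis using \<open>\<And>n. \<tau> (e n) x / B (e n) = 0\<close>[of n] Bnz[of i] by simp
      qed
      thus "\<tau> n x = 0" for n by (rule tau_I)
    qed
    show "\<tau> (e 0) x / B (e 0) = \<tau> 0 x / B 0" for x by (simp add: e0)
  qed
qed

section \<open>Countably subadditive functionals and Schauder bases\<close>

text \<open>
  Zabreiko's lemma, from which the boundedness principles for Banach spaces follow. By Baire's
  theorem some sublevel set of \<open>q\<close> is dense in a ball; hence every vector can be approximated
  arbitrarily well by vectors whose \<open>q\<close> is controlled by its norm. Iterating this on the
  remainders writes the vector as a series, and countable subadditivity bounds its \<open>q\<close>.
\<close>
lemma countably_subadditive_bounded:
  fixes q :: "'a::banach \<Rightarrow> real"
  assumes nonneg: "\<And>x. 0 \<le> q x"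
    and scale: "\<And>c x. q (c *\<^sub>R x) \<le> \<bar>c\<bar> * q x"
    and csub: "\<And>X. summable X \<Longrightarrow> summable (\<lambda>n. q (X n)) \<Longrightarrow> q (\<Sum>n. X n) \<le> (\<Sum>n. q (X n))"
  shows "\<exists>C>0. \<forall>x. q x \<le> C * norm x"
proof -
  have q0: "q 0 = 0" using scale[of 0 0] nonneg[of 0] by simp
  have tri: "q (x - y) \<le> q x + q y" for x y
  proof -
    define X where "X n = (if n = 0 then x else if n = 1 then - y else 0)" for n :: nat
    have X: "X n = 0" if "n \<notin> {0, 1}" for n using that by (simp add: X_def)
    have "q (\<Sum>n. X n) \<le> (\<Sum>n. q (X n))"
      using X q0 by (intro csub summable_finite[of "{0, 1}"]) auto
    also have "(\<Sum>n. X n) = (\<Sum>n\<in>{0, 1}. X n)" using X by (intro suminf_finite) auto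
    also have "(\<Sum>n. q (X n)) = (\<Sum>n\<in>{0, 1}. q (X n))" using X q0 by (intro suminf_finite) auto
    finally have "q (x - y) \<le> q x + q (- y)" by (simp add: X_def)
    moreover have "q (- y) \<le> q y" using scale[of "-1" y] by simp
    ultimately show ?thesis by linarith
  qed
  \<comment> \<open>The sets \<open>A n\<close> cover the space, so one of their closures contains a ball.\<close>
  define A where "A n = {x. q x \<le> real n}" for n
  have "\<exists>n. interior (closure (A n)) \<noteq> {}"
  proof (rule ccontr)
    assume neg: "\<not> ?thesis"
    have "Met_TC.mtopology interior_of \<Union>(range (\<lambda>n. closure (A n))) = {}"
      using neg by (intro Met_TC.metric_Baire_category_alt) (auto simp: complete_UNIV)
    moreover have "\<Union>(range (\<lambda>n. closure (A n))) = UNIV"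
    proof -
      have "x \<in> A (nat \<lceil>q x\<rceil>)" for x unfolding A_def by (simp add: real_nat_ceiling_ge)
      thus ?thesis using closure_subset by blast
    qed
    ultimately show False by simp
  qed
  then obtain n x0 r where r: "r > 0" "ball x0 r \<subseteq> closure (A n)"
    by (metis all_not_in_conv mem_interior)
  define M where "M = 2 * real n"
  have approx: "\<exists>u. q u \<le> M \<and> norm (y - u) < e" if y: "norm y < r" and e: "e > 0" for y e
  proof -
    have "x0 + y \<in> closure (A n)" "x0 \<in> closure (A n)" using r y by (auto intro!: subsetD[OF r(2)] simp: dist_norm)
    then obtain a b where ab: "a \<in> A n" "dist a (x0 + y) < e / 2" "b \<in> A n" "dist b x0 < e / 2"
      using e by (metis closure_approachable half_gt_zero)
    have "norm (y - (a - b)) = norm ((b - x0) - (a - (x0 + y)))" by (simp add: algebra_simps)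
    also have "\<dots> \<le> norm (b - x0) + norm (a - (x0 + y))" by (rule norm_triangle_ineq4)
    also have "\<dots> < e" using ab by (simp add: dist_norm)
    finally have "norm (y - (a - b)) < e" .
    moreover have "q (a - b) \<le> M" using tri[of a b] ab by (simp add: A_def M_def)
    ultimately show ?thesis by blast
  qed
  define K where "K = 2 * M / r"
  have M: "M \<ge> 0" by (simp add: M_def)
  have K: "K \<ge> 0" using r M by (simp add: K_def)
  have approx': "\<exists>u. q u \<le> K * norm y \<and> norm (y - u) < e" if e: "e > 0" for y e
  proof (cases "y = 0")
    case True thus ?thesis using e q0 by (intro exI[of _ 0]) simp
  next
    case False
    define c where "c = r / (2 * norm y)"
    have c: "c > 0" using r False by (simp add: c_def)
    have "norm (c *\<^sub>R y) < r" using r False by (simp add: c_def)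
    then obtain u where u: "q u \<le> M" "norm (c *\<^sub>R y - u) < c * e" using approx[of "c *\<^sub>R y" "c * e"] c e by auto
    have "q (inverse c *\<^sub>R u) \<le> inverse c * M"
      using scale[of "inverse c" u] u(1) c by (simp add: field_simps)
    also have "\<dots> = K * norm y" using r False by (simp add: c_def K_def field_simps)
    finally have "q (inverse c *\<^sub>R u) \<le> K * norm y" .
    moreover have "norm (y - inverse c *\<^sub>R u) < e"
    proof -
      have "y - inverse c *\<^sub>R u = inverse c *\<^sub>R (c *\<^sub>R y - u)" using c by (simp add: scaleR_diff_right)
      hence "norm (y - inverse c *\<^sub>R u) = inverse c * norm (c *\<^sub>R y - u)" using c by simp
      also have "\<dots> < inverse c * (c * e)" using u(2) c by (intro mult_strict_left_mono) auto
      also have "\<dots> = e" using c by simp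
      finally show ?thesis .
    qed
    ultimately show ?thesis by blast
  qed
  define U where "U y e = (SOME u. q u \<le> K * norm y \<and> norm (y - u) < e)" for y e
  have U: "q (U y e) \<le> K * norm y" "norm (y - U y e) < e" if "e > 0" for y e
    using someI_ex[OF approx'[OF that, of y]] unfolding U_def by blast+
  have main: "q x \<le> 2 * K * norm x" if "x \<noteq> 0" for x
  proof -
    define b where "b = norm x"
    have b: "b > 0" using that by (simp add: b_def)
    \<comment> \<open>\<open>Y n\<close> is what remains of \<open>x\<close> after \<open>n\<close> approximations; the summand \<open>V n\<close> halves the error.\<close>
    define Y where "Y = rec_nat x (\<lambda>n y. y - U y (b * (1/2) ^ Suc n))"
    define V where "V n = U (Y n) (b * (1/2) ^ Suc n)" for n
    have Y0: "Y 0 = x" and YS: "Y (Suc n) = Y n - V n" for n by (simp_all add: Y_def V_def)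
    have nY: "norm (Y n) \<le> b * (1/2) ^ n" for n
    proof (cases n)
      case 0 thus ?thesis by (simp add: Y0 b_def)
    next
      case (Suc m)
      show ?thesis unfolding Suc YS V_def using U(2)[of "b * (1/2) ^ Suc m" "Y m"] b by (simp add: less_imp_le)
    qed
    have qV: "q (V n) \<le> K * b * (1/2) ^ n" for n
    proof -
      have "q (V n) \<le> K * norm (Y n)" unfolding V_def using b by (intro U(1)) simp
      also have "\<dots> \<le> K * (b * (1/2) ^ n)" using nY K by (intro mult_left_mono) auto
      finally show ?thesis by simp
    qed
    have part: "(\<Sum>i<n. V i) = x - Y n" for n by (induction n) (auto simp: Y0 YS)
    have "Y \<longlonglongrightarrow> 0"
    proof (rule Lim_null_comparison)
      show "eventually (\<lambda>n. norm (Y n) \<le> b * (1/2) ^ n) sequentially" using nY by simp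
      have "(\<lambda>n. b * (1/2) ^ n) \<longlonglongrightarrow> b * 0" by (intro tendsto_intros LIMSEQ_realpow_zero) auto
      thus "(\<lambda>n. b * (1/2) ^ n) \<longlonglongrightarrow> 0" by simp
    qed
    hence "(\<lambda>n. x - Y n) \<longlonglongrightarrow> x - 0" by (intro tendsto_intros)
    hence sums: "V sums x" by (simp add: sums_def part)
    have geo: "summable (\<lambda>n. K * b * (1/2) ^ n)" by (intro summable_mult summable_geometric) auto
    have sq: "summable (\<lambda>n. q (V n))"
      by (rule summable_comparison_test[OF _ geo]) (use nonneg qV in auto)
    have "q x \<le> (\<Sum>n. q (V n))" using csub[OF sums_summable[OF sums] sq] sums_unique[OF sums] by simp
    also have "\<dots> \<le> (\<Sum>n. K * b * (1/2) ^ n)" by (intro suminf_le qV sq geo)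
    also have "\<dots> = 2 * K * b" using suminf_mult[of "\<lambda>n. (1/2::real) ^ n" "K * b"] suminf_geometric[of "1/2::real"]
      by (simp add: summable_geometric)
    finally show ?thesis by (simp add: b_def)
  qed
  have "q x \<le> (2 * K + 1) * norm x" for x
  proof (cases "x = 0")
    case False
    have "q x \<le> 2 * K * norm x + 1 * norm x" using main[OF False] norm_ge_zero[of x] by linarith
    thus ?thesis by (simp add: distrib_right)
  qed (use q0 in auto)
  thus ?thesis using K by (intro exI[of _ "2 * K + 1"]) auto
qed

lemma schauder_basis_coeff:
  assumes "schauder_basis s"
  obtains co where "\<And>x. (\<lambda>n. co x n *\<^sub>R s n) sums x"
    "\<And>a x. (\<lambda>n. a n *\<^sub>R s n) sums x \<Longrightarrow> a = co x"
  using assms unfolding schauder_basis_def by metis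

lemma schauder_basis_nonzero:
  assumes "schauder_basis s" shows "s i \<noteq> 0"
proof
  assume "s i = 0"
  obtain co where co: "\<And>a x. (\<lambda>n. a n *\<^sub>R s n) sums x \<Longrightarrow> a = co x"
    using schauder_basis_coeff[OF assms] by metis
  have "(\<lambda>n. (if n = i then c else 0) *\<^sub>R s n) sums 0" for c :: real
    using \<open>s i = 0\<close> by (intro sums_0) auto
  hence "(\<lambda>n. if n = i then c else 0) = co 0" for c :: real by (rule co)
  from fun_cong[OF this[of 1], of i] fun_cong[OF this[of 0], of i] show False by simp
qed

text \<open>
  The supremum \<open>q\<close> of the norms of the partial sums is countably subadditive: if the \<open>q (X k)\<close> are
  summable, then the coefficients of the \<open>X k\<close> may be added up, and the resulting series
  converges to the sum of the \<open>X k\<close> because its partial sums are dominated uniformly. Zabreiko's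
  lemma then bounds \<open>q\<close> by the norm.
\<close>
lemma basis_constant:
  fixes s :: "nat \<Rightarrow> 's::banach"
  assumes "schauder_basis s"
  shows "\<exists>C>0. \<forall>a n. summable (\<lambda>i. a i *\<^sub>R s i) \<longrightarrow>
           norm (\<Sum>i<n. a i *\<^sub>R s i) \<le> C * norm (\<Sum>i. a i *\<^sub>R s i)"
proof -
  obtain co where co: "\<And>x. (\<lambda>n. co x n *\<^sub>R s n) sums x"
    and uni: "\<And>a x. (\<lambda>n. a n *\<^sub>R s n) sums x \<Longrightarrow> a = co x"
    using schauder_basis_coeff[OF assms] by metis
  define P where "P n x = (\<Sum>i<n. co x i *\<^sub>R s i)" for n x
  define q where "q x = (SUP n. norm (P n x))" for x
  have lim: "(\<lambda>n. P n x) \<longlonglongrightarrow> x" for x using co[of x] by (simp add: sums_def P_def)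
  have bdd: "bdd_above (range (\<lambda>n. norm (P n x)))" for x
  proof -
    obtain K where "\<forall>n. norm (P n x) \<le> K"
      using convergent_imp_Bseq[OF convergentI[OF lim[of x]]] unfolding Bseq_def by blast
    thus ?thesis by (intro bdd_aboveI[of _ K]) auto
  qed
  have P_le: "norm (P n x) \<le> q x" for n x unfolding q_def by (rule cSUP_upper[OF _ bdd]) simp
  have q_le: "q x \<le> c" if "\<And>n. norm (P n x) \<le> c" for x c unfolding q_def by (rule cSUP_least) (use that in auto)
  have "\<exists>C>0. \<forall>x. q x \<le> C * norm x"
  proof (rule countably_subadditive_bounded)
    show nonneg: "0 \<le> q x" for x using P_le[of 0 x] by (simp add: P_def)
    show "q (c *\<^sub>R x) \<le> \<bar>c\<bar> * q x" for c x
    proof (rule q_le)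
      fix n
      have "(\<lambda>n. c *\<^sub>R (co x n *\<^sub>R s n)) sums (c *\<^sub>R x)" by (rule sums_scaleR_right[OF co])
      hence "(\<lambda>n. c * co x n) = co (c *\<^sub>R x)" by (intro uni) simp
      hence "P n (c *\<^sub>R x) = c *\<^sub>R P n x" by (simp add: P_def scaleR_sum_right fun_eq_iff)
      thus "norm (P n (c *\<^sub>R x)) \<le> \<bar>c\<bar> * q x" using P_le[of n x] by (simp add: mult_left_mono)
    qed
    show "q (\<Sum>n. X n) \<le> (\<Sum>n. q (X n))" if X: "summable X" "summable (\<lambda>n. q (X n))" for X
    proof -
      have coeff_bound: "norm (co x i *\<^sub>R s i) \<le> 2 * q x" for x i
      proof -
        have "co x i *\<^sub>R s i = P (Suc i) x - P i x" by (simp add: P_def)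
        also have "norm \<dots> \<le> norm (P (Suc i) x) + norm (P i x)" by (rule norm_triangle_ineq4)
        finally show ?thesis using P_le[of "Suc i" x] P_le[of i x] by linarith
      qed
      have sum_co: "summable (\<lambda>k. co (X k) i)" for i
      proof (rule summable_comparison_test[OF _ summable_mult[OF X(2), of "2 / norm (s i)"]])
        have "norm (co (X k) i) \<le> 2 / norm (s i) * q (X k)" for k
          using coeff_bound[of "X k" i] schauder_basis_nonzero[OF assms, of i] by (simp add: field_simps)
        thus "\<exists>N. \<forall>k\<ge>N. norm (co (X k) i) \<le> 2 / norm (s i) * q (X k)" by blast
      qed
      define b where "b i = (\<Sum>k. co (X k) i)" for i
      have nP: "summable (\<lambda>k. norm (P n (X k)))" for n
        by (rule summable_comparison_test[OF _ X(2)]) (use P_le in auto)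
      have bP: "(\<Sum>i<n. b i *\<^sub>R s i) = (\<Sum>k. P n (X k))" for n
      proof -
        have "(\<Sum>i<n. b i *\<^sub>R s i) = (\<Sum>i<n. \<Sum>k. co (X k) i *\<^sub>R s i)"
          by (simp add: b_def suminf_scaleR_left[OF sum_co])
        also have "\<dots> = (\<Sum>k. \<Sum>i<n. co (X k) i *\<^sub>R s i)"
          by (rule suminf_sum[symmetric]) (intro summable_scaleR_left sum_co)
        finally show ?thesis by (simp add: P_def)
      qed
      \<comment> \<open>Dominated convergence for series, applied to the real numbers \<open>norm (P n (X k) - X k)\<close>.\<close>
      have diffs: "(\<lambda>n. \<Sum>k. norm (P n (X k) - X k)) \<longlonglongrightarrow> (\<Sum>k. 0)"
      proof (intro tannerys_theorem[THEN conjunct2, THEN conjunct2])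
        show "(\<lambda>n. norm (P n (X k) - X k)) \<longlonglongrightarrow> 0" for k
          using tendsto_norm[OF tendsto_diff[OF lim[of "X k"] tendsto_const[of "X k"]]] by simp
        show "summable (\<lambda>k. 2 * q (X k))" by (intro summable_mult X)
        have "norm x \<le> q x" for x
          by (rule LIMSEQ_le_const2[OF tendsto_norm[OF lim]]) (use P_le in auto)
        hence "norm (P n x - x) \<le> 2 * q x" for n x
          using norm_triangle_ineq4[of "P n x" x] P_le[of n x] by (smt (verit))
        hence "norm (norm (P n x - x)) \<le> 2 * q x" for n x by simp
        thus "\<forall>\<^sub>F (k, n) in sequentially \<times>\<^sub>F sequentially. norm (norm (P n (X k) - X k)) \<le> 2 * q (X k)"
          by (intro always_eventually) auto
      qed auto
      have "(\<lambda>n. \<Sum>i<n. b i *\<^sub>R s i) \<longlonglongrightarrow> (\<Sum>k. X k)"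
      proof (rule Lim_transform_eventually[OF _ always_eventually, of "\<lambda>n. (\<Sum>k. P n (X k) - X k) + (\<Sum>k. X k)"])
        have sP: "summable (\<lambda>k. P n (X k))" for n by (rule summable_norm_cancel[OF nP])
        have "norm (P n (X k) - X k) \<le> norm (P n (X k)) + q (X k)" for n k
        proof -
          have "norm (X k) \<le> q (X k)" 
            by (rule LIMSEQ_le_const2[OF tendsto_norm[OF lim]]) (use P_le in auto)
          thus ?thesis using norm_triangle_ineq4[of "P n (X k)" "X k"] by linarith
        qed
        hence sd: "summable (\<lambda>k. norm (P n (X k) - X k))" for n
          by (intro summable_comparison_test[OF _ summable_add[OF nP[of n] X(2)]]) auto
        have "(\<lambda>n. \<Sum>k. P n (X k) - X k) \<longlonglongrightarrow> 0"
          by (rule Lim_null_comparison[OF _ diffs[simplified]]) (simp add: summable_norm[OF sd])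
        from tendsto_add[OF this tendsto_const]
        show "(\<lambda>n. (\<Sum>k. P n (X k) - X k) + (\<Sum>k. X k)) \<longlonglongrightarrow> (\<Sum>k. X k)" by simp
        show "\<forall>n. (\<Sum>k. P n (X k) - X k) + (\<Sum>k. X k) = (\<Sum>i<n. b i *\<^sub>R s i)"
          by (simp add: bP suminf_diff[OF sP X(1), symmetric])
      qed
      hence "b = co (\<Sum>k. X k)" by (intro uni) (simp add: sums_def)
      hence P_sum: "P n (\<Sum>k. X k) = (\<Sum>k. P n (X k))" for n using bP[of n] by (simp add: P_def)
      show ?thesis
      proof (rule q_le)
        fix n
        have "norm (P n (\<Sum>k. X k)) \<le> (\<Sum>k. norm (P n (X k)))" unfolding P_sum by (rule summable_norm[OF nP])
        also have "\<dots> \<le> (\<Sum>k. q (X k))" by (intro suminf_le P_le nP X)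
        finally show "norm (P n (\<Sum>k. X k)) \<le> (\<Sum>k. q (X k))" .
      qed
    qed
  qed
  then obtain C where C: "C > 0" "\<And>x. q x \<le> C * norm x" by blast
  have "norm (\<Sum>i<n. a i *\<^sub>R s i) \<le> C * norm (\<Sum>i. a i *\<^sub>R s i)" if "summable (\<lambda>i. a i *\<^sub>R s i)" for a n
  proof -
    have "a = co (\<Sum>i. a i *\<^sub>R s i)" by (rule uni[OF summable_sums[OF that]])
    hence "(\<Sum>i<n. a i *\<^sub>R s i) = P n (\<Sum>i. a i *\<^sub>R s i)" by (simp add: P_def)
    thus ?thesis using P_le[of n] C(2) by (metis order_trans)
  qed
  thus ?thesis using C(1) by blast
qed

section \<open>Permutations of a symmetric basis\<close>

lemma finite_support_sums:
  fixes a :: "nat \<Rightarrow> real" and s :: "nat \<Rightarrow> 's::real_normed_vector"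
  assumes "finite A" "\<And>i. i \<notin> A \<Longrightarrow> a i = 0"
  shows "(\<lambda>i. a i *\<^sub>R s i) sums (\<Sum>i\<in>A. a i *\<^sub>R s i)"
  by (rule sums_finite) (use assms in auto)

lemma basis_coeff_bound:
  fixes s :: "nat \<Rightarrow> 's::banach"
  assumes "schauder_basis s"
  shows "\<exists>C>0. \<forall>a i. summable (\<lambda>i. a i *\<^sub>R s i) \<longrightarrow> \<bar>a i\<bar> * norm (s i) \<le> C * norm (\<Sum>i. a i *\<^sub>R s i)"
proof -
  obtain C where C: "C > 0" "\<And>a n. summable (\<lambda>i. a i *\<^sub>R s i) \<Longrightarrow>
           norm (\<Sum>i<n. a i *\<^sub>R s i) \<le> C * norm (\<Sum>i. a i *\<^sub>R s i)"
    using basis_constant[OF assms] by blast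
  have "\<bar>a i\<bar> * norm (s i) \<le> (2 * C) * norm (\<Sum>i. a i *\<^sub>R s i)" if a: "summable (\<lambda>i. a i *\<^sub>R s i)" for a i
  proof -
    have "\<bar>a i\<bar> * norm (s i) = norm ((\<Sum>i<Suc i. a i *\<^sub>R s i) - (\<Sum>i<i. a i *\<^sub>R s i))" by simp
    also have "\<dots> \<le> norm (\<Sum>i<Suc i. a i *\<^sub>R s i) + norm (\<Sum>i<i. a i *\<^sub>R s i)" by (rule norm_triangle_ineq4)
    also have "\<dots> \<le> (2 * C) * norm (\<Sum>i. a i *\<^sub>R s i)" using C(2)[OF a, of "Suc i"] C(2)[OF a, of i] by linarith
    finally show ?thesis .
  qed
  thus ?thesis using C(1) by (intro exI[of _ "2 * C"]) auto
qed

text \<open>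
  The gliding hump. If arbitrarily far out there were vectors of arbitrarily small norm, each
  supported on an interval, that a permutation of the interval makes large, then one could choose
  such intervals one after the other and glue. The vectors add up to a convergent series, while
  the series with permuted basis vectors is not Cauchy; this contradicts the equivalence of the
  basis with its permutation.
\<close>
lemma symmetric_basis_no_blocks:
  fixes s :: "nat \<Rightarrow> 's::banach"
  assumes sym: "symmetric_basis s"
    and blocks: "\<And>(M::nat) (e::real). e > 0 \<Longrightarrow> \<exists>M'>M. \<exists>a \<pi>. \<pi> permutes {M..<M'} \<and>
        norm (\<Sum>i\<in>{M..<M'}. a i *\<^sub>R s i) \<le> e \<and> norm (\<Sum>i\<in>{M..<M'}. a i *\<^sub>R s (\<pi> i)) \<ge> 1"
  shows False
proof -
  have basis: "schauder_basis s" using sym by (simp add: symmetric_basis_def)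
  obtain co where co: "\<And>x. (\<lambda>n. co x n *\<^sub>R s n) sums x"
    and uni: "\<And>a x. (\<lambda>n. a n *\<^sub>R s n) sums x \<Longrightarrow> a = co x"
    using schauder_basis_coeff[OF basis] by metis
  have co_linear: "linear (\<lambda>x. co x i)" for i
  proof (rule linearI)
    fix x y
    have "(\<lambda>n. (co x n + co y n) *\<^sub>R s n) sums (x + y)"
      using sums_add[OF co co] by (simp add: scaleR_add_left)
    from fun_cong[OF uni[OF this], of i] show "co (x + y) i = co x i + co y i" by simp
  next
    fix c x
    have "(\<lambda>n. (c * co x n) *\<^sub>R s n) sums (c *\<^sub>R x)"
      using sums_scaleR_right[OF co] by simp
    from fun_cong[OF uni[OF this], of i] show "co (c *\<^sub>R x) i = c *\<^sub>R co x i" by simp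
  qed
  have co_bounded: "bounded_linear (\<lambda>x. co x i)" for i
  proof -
    obtain C where C: "C > 0" "\<And>a i. summable (\<lambda>i. a i *\<^sub>R s i) \<Longrightarrow>
        \<bar>a i\<bar> * norm (s i) \<le> C * norm (\<Sum>i. a i *\<^sub>R s i)"
      using basis_coeff_bound[OF basis] by blast
    have "norm (co x i) \<le> norm x * (C / norm (s i))" for x
      using C(2)[OF sums_summable[OF co[of x]], of i] sums_unique[OF co[of x]]
        schauder_basis_nonzero[OF basis, of i] by (simp add: field_simps)
    thus ?thesis by (intro bounded_linear.intro co_linear bounded_linear_axioms.intro) blast
  qed
  define good where "good M e M' a \<pi> \<longleftrightarrow> M' > M \<and> \<pi> permutes {M..<M'} \<and>
        norm (\<Sum>i\<in>{M..<M'}. a i *\<^sub>R s i) \<le> e \<and> norm (\<Sum>i\<in>{M..<M'}. a i *\<^sub>R s (\<pi> i)) \<ge> 1"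
    for M M' :: nat and e :: real and a :: "nat \<Rightarrow> real" and \<pi> :: "nat \<Rightarrow> nat"
  have "\<exists>f. \<forall>k. True \<and> (\<exists>a \<pi>. good (f k) ((1/2) ^ k) (f (Suc k)) a \<pi>)"
    using blocks[of "(1/2) ^ _"] by (intro dependent_nat_choice) (auto simp: good_def)
  then obtain m where "\<And>k. \<exists>a \<pi>. good (m k) ((1/2) ^ k) (m (Suc k)) a \<pi>" by blast
  then obtain A p where "\<And>k. good (m k) ((1/2) ^ k) (m (Suc k)) (A k) (p k)" by metis
  hence m_less: "m k < m (Suc k)" and perm: "p k permutes {m k..<m (Suc k)}"
    and small: "norm (\<Sum>i\<in>{m k..<m (Suc k)}. A k i *\<^sub>R s i) \<le> (1/2) ^ k"
    and large: "norm (\<Sum>i\<in>{m k..<m (Suc k)}. A k i *\<^sub>R s (p k i)) \<ge> 1" for k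
    by (auto simp: good_def)
  have mono: "strict_mono m" using m_less by (simp add: strict_mono_Suc_iff)
  define B where "B k = {m k..<m (Suc k)}" for k
  have B_disj: "k = l" if "i \<in> B k" "i \<in> B l" for i k l
  proof (rule ccontr)
    assume "k \<noteq> l"
    then consider "Suc k \<le> l" | "Suc l \<le> k" by linarith
    thus False
      using that strict_mono_less_eq[OF mono, of "Suc k" l] strict_mono_less_eq[OF mono, of "Suc l" k]
      by cases (auto simp: B_def)
  qed
  define a where "a i = (if \<exists>k. i \<in> B k then A (THE k. i \<in> B k) i else 0)" for i
  define \<pi> where "\<pi> i = (if \<exists>k. i \<in> B k then p (THE k. i \<in> B k) i else i)" for i
  have the_B: "(THE k. i \<in> B k) = k" if "i \<in> B k" for i k
    using that B_disj by (intro the_equality) auto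
  have a_B: "a i = A k i" and pi_B: "\<pi> i = p k i" if "i \<in> B k" for i k
    using that the_B[OF that] by (auto simp: a_def \<pi>_def)
  have a_0: "a i = 0" and pi_out: "\<pi> i = i" if "\<And>k. i \<notin> B k" for i
    using that by (auto simp: a_def \<pi>_def)
  have pB: "p k i \<in> B k" if "i \<in> B k" for i k
    using permutes_in_image[OF perm[of k], of i] that by (simp add: B_def)
  have "bij \<pi>"
  proof (rule bijI)
    show "inj \<pi>"
    proof (rule injI)
      fix i i' assume eq: "\<pi> i = \<pi> i'"
      show "i = i'"
      proof (cases "\<exists>k. i \<in> B k")
        case True
        then obtain k where k: "i \<in> B k" by blast
        hence "\<pi> i' \<in> B k" using pi_B pB eq by metis
        hence "i' \<in> B k" using pi_B pB pi_out B_disj by metis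
        hence "p k i = p k i'" using eq k pi_B by metis
        thus ?thesis using permutes_inj[OF perm[of k]] by (meson injD)
      next
        case False
        hence "\<pi> i' \<notin> B k" for k using eq pi_out by metis
        hence "i' \<notin> B k" for k using pi_B pB by metis
        thus ?thesis using False eq pi_out by metis
      qed
    qed
    show "surj \<pi>"
    proof (rule surjI[of _ "\<lambda>i. if \<exists>k. i \<in> B k then inv_into UNIV (p (THE k. i \<in> B k)) i else i"])
      fix i
      show "\<pi> (if \<exists>k. i \<in> B k then inv_into UNIV (p (THE k. i \<in> B k)) i else i) = i"
      proof (cases "\<exists>k. i \<in> B k")
        case True
        then obtain k where k: "i \<in> B k" by blast
        have "inv_into UNIV (p k) i \<in> B k"
          using permutes_in_image[OF permutes_inv[OF perm[of k]], of i] k by (simp add: B_def)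
        thus ?thesis using True the_B[OF k] pi_B permutes_inverses(1)[OF perm[of k]] by simp
      next
        case False thus ?thesis using pi_out by auto
      qed
    qed
  qed
  have "summable (\<lambda>i. a i *\<^sub>R s i)"
  proof -
    \<comment> \<open>The blocks form an absolutely convergent series. The coefficient functionals are
      continuous, so the basis expansion of its sum is the glued sequence \<open>a\<close>.\<close>
    define X where "X k = (\<Sum>i\<in>B k. a i *\<^sub>R s i)" for k
    have "X k = (\<Sum>i\<in>B k. A k i *\<^sub>R s i)" for k unfolding X_def using a_B by (intro sum.cong) auto
    hence "norm (X k) \<le> (1/2) ^ k" for k using small[of k] by (simp add: B_def)
    hence X: "summable X" by (intro summable_comparison_test[OF _ summable_geometric[of "1/2"]]) auto
    have co_X: "co (X k) i = (if i \<in> B k then a i else 0)" for k i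
    proof -
      have "(\<lambda>i. (if i \<in> B k then a i else 0) *\<^sub>R s i) sums (\<Sum>i\<in>B k. (if i \<in> B k then a i else 0) *\<^sub>R s i)"
        by (rule finite_support_sums) (auto simp: B_def)
      also have "(\<Sum>i\<in>B k. (if i \<in> B k then a i else 0) *\<^sub>R s i) = X k" unfolding X_def by (intro sum.cong) auto
      finally have "(\<lambda>i. (if i \<in> B k then a i else 0) *\<^sub>R s i) sums X k" .
      from fun_cong[OF uni[OF this], of i] show ?thesis by simp
    qed
    have "co (\<Sum>k. X k) i = a i" for i
    proof -
      have eq: "co (\<Sum>k. X k) i = (\<Sum>k. co (X k) i)" by (rule bounded_linear.suminf[OF co_bounded X])
      show ?thesis
      proof (cases "\<exists>k. i \<in> B k")
        case True
        then obtain k where k: "i \<in> B k" by blast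
        have "(\<Sum>l. co (X l) i) = (\<Sum>l\<in>{k}. co (X l) i)"
          using k B_disj by (intro suminf_finite) (auto simp: co_X)
        thus ?thesis using eq k by (simp add: co_X)
      next
        case False
        thus ?thesis using eq a_0 by (simp add: co_X)
      qed
    qed
    hence "co (\<Sum>k. X k) = a" by blast
    with co[of "\<Sum>k. X k"] have "(\<lambda>i. a i *\<^sub>R s i) sums (\<Sum>k. X k)" by simp
    thus ?thesis by (rule sums_summable)
  qed
  hence "summable (\<lambda>i. a i *\<^sub>R s (\<pi> i))"
    using sym \<open>bij \<pi>\<close> unfolding symmetric_basis_def equivalent_sequences_def comp_def by blast
  then obtain n where n: "\<And>m' n'. m' \<ge> n \<Longrightarrow> norm (\<Sum>i\<in>{m'..<n'}. a i *\<^sub>R s (\<pi> i)) < 1"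
    unfolding summable_Cauchy by (metis zero_less_one)
  have "norm (\<Sum>i\<in>{m n..<m (Suc n)}. a i *\<^sub>R s (\<pi> i)) < 1"
    by (rule n) (rule strict_mono_imp_increasing[OF mono])
  also have "(\<Sum>i\<in>{m n..<m (Suc n)}. a i *\<^sub>R s (\<pi> i)) = (\<Sum>i\<in>{m n..<m (Suc n)}. A n i *\<^sub>R s (p n i))"
    using a_B pi_B by (intro sum.cong) (auto simp: B_def)
  finally show False using large[of n] by linarith
qed

text \<open>
  Otherwise the quotient of two norms is large even for indices beyond a given one, and
  exchanging two such indices is a block as excluded above.
\<close>
lemma symmetric_basis_norm_ratio:
  fixes s :: "nat \<Rightarrow> 's::banach"
  assumes sym: "symmetric_basis s"
  shows "\<exists>K. \<forall>i j. norm (s i) \<le> K * norm (s j)"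
proof (rule ccontr)
  assume "\<not> ?thesis"
  hence ratio: "\<And>K. \<exists>i j. norm (s i) > K * norm (s j)" by (meson not_le)
  have basis: "schauder_basis s" using sym by (simp add: symmetric_basis_def)
  have pos: "norm (s i) > 0" for i using schauder_basis_nonzero[OF basis] by simp
  have far: "\<exists>i\<ge>M. \<exists>j\<ge>M. norm (s i) > K * norm (s j)" if K: "K \<ge> 1" for M K
  proof -
    define lo where "lo = Min ((\<lambda>i. norm (s i)) ` {..M})"
    define hi where "hi = Max ((\<lambda>i. norm (s i)) ` {..M})"
    have lo: "lo \<le> norm (s i)" and hi: "norm (s i) \<le> hi" if "i \<le> M" for i
      using that by (auto simp: lo_def hi_def)
    have "lo \<in> (\<lambda>i. norm (s i)) ` {..M}" unfolding lo_def by (rule Min_in) auto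
    hence lo_pos: "lo > 0" using pos by auto
    have lohi: "lo \<le> hi" using lo[of 0] hi[of 0] by simp
    \<comment> \<open>A quotient this large cannot come from the indices up to \<open>M\<close> alone; if one of the two
      indices is small, then \<open>M\<close> replaces it.\<close>
    obtain i j where ij: "norm (s i) > K * hi / lo * norm (s j)" using ratio by blast
    have big: "K * hi \<ge> K * norm (s M)" using hi[of M] K by simp
    have K': "K \<le> K * hi / lo"
    proof -
      have "K * lo \<le> K * hi" using K lohi by simp
      thus ?thesis using lo_pos by (simp add: field_simps)
    qed
    show ?thesis
    proof (cases "i < M")
      case True
      have "K * hi / lo * norm (s j) < hi" using ij hi[of i] True by linarith
      hence *: "K * norm (s j) < lo" using lo_pos lohi by (simp add: field_simps)
      have "1 * norm (s j) \<le> K * norm (s j)" using K by (intro mult_right_mono) auto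
      hence "norm (s j) < lo" using * by linarith
      hence "j \<ge> M" using lo[of j] by (cases "j < M") auto
      moreover have "K * norm (s j) < norm (s M)" using * lo[of M] by simp
      ultimately show ?thesis by blast
    next
      case i: False
      show ?thesis
      proof (cases "j < M")
        case True
        have "K * hi = K * hi / lo * lo" using lo_pos by simp
        also have "\<dots> \<le> K * hi / lo * norm (s j)"
          using lo[of j] True lo_pos lohi K by (intro mult_left_mono divide_nonneg_nonneg mult_nonneg_nonneg) auto
        finally have "norm (s i) > K * norm (s M)" using ij big by linarith
        thus ?thesis using i by (intro exI[of _ i] conjI exI[of _ M]) auto
      next
        case False
        have "K * norm (s j) \<le> K * hi / lo * norm (s j)" using K' by (intro mult_right_mono) auto
        thus ?thesis using ij i False by (intro exI[of _ i] conjI exI[of _ j]) auto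
      qed
    qed
  qed
  show False
  proof (rule symmetric_basis_no_blocks[OF sym])
    fix M :: nat and e :: real assume e: "e > 0"
    obtain i j where ij: "i \<ge> M" "j \<ge> M" "norm (s i) > max 1 (1 / e) * norm (s j)"
      using far[of "max 1 (1 / e)" M] by auto
    have less: "norm (s i) > norm (s j)" "norm (s i) > 1 / e * norm (s j)"
    proof -
      have "1 * norm (s j) \<le> max 1 (1 / e) * norm (s j)" "1 / e * norm (s j) \<le> max 1 (1 / e) * norm (s j)"
        by (intro mult_right_mono; simp)+
      thus "norm (s i) > norm (s j)" "norm (s i) > 1 / e * norm (s j)" using ij by linarith+
    qed
    define M' where "M' = Suc (max i j)"
    define a where "a k = (if k = j then 1 / norm (s i) else 0)" for k
    define \<pi> where "\<pi> = Transposition.transpose i j"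
    have "\<pi> permutes {M..<M'}" unfolding \<pi>_def using ij by (intro permutes_swap_id) (auto simp: M'_def)
    moreover have "(\<Sum>k\<in>{M..<M'}. a k *\<^sub>R x k) = (1 / norm (s i)) *\<^sub>R x j" for x :: "nat \<Rightarrow> 's"
    proof -
      have "(\<Sum>k\<in>{M..<M'}. a k *\<^sub>R x k) = (\<Sum>k\<in>{M..<M'}. if k = j then (1 / norm (s i)) *\<^sub>R x j else 0)"
        by (intro sum.cong) (auto simp: a_def)
      also have "\<dots> = (1 / norm (s i)) *\<^sub>R x j" using ij by (simp add: M'_def)
      finally show ?thesis .
    qed
    moreover have "norm (s j) / norm (s i) \<le> e" using less e pos[of i] by (simp add: field_simps)
    ultimately have "\<pi> permutes {M..<M'} \<and> norm (\<Sum>k\<in>{M..<M'}. a k *\<^sub>R s k) \<le> e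
       \<and> norm (\<Sum>k\<in>{M..<M'}. a k *\<^sub>R s (\<pi> k)) \<ge> 1"
      using pos[of i] by (simp add: \<pi>_def)
    moreover have "M' > M" using ij by (simp add: M'_def)
    ultimately show "\<exists>M'>M. \<exists>a \<pi>. \<pi> permutes {M..<M'} \<and>
        norm (\<Sum>i\<in>{M..<M'}. a i *\<^sub>R s i) \<le> e \<and> norm (\<Sum>i\<in>{M..<M'}. a i *\<^sub>R s (\<pi> i)) \<ge> 1"
      by blast
  qed
qed

text \<open>
  The two complements have the same number of elements.
\<close>
lemma inj_on_finite_extends_permutation:
  assumes A: "finite A" "inj_on \<tau> A'" "A' \<subseteq> A" "\<tau> ` A' \<subseteq> A"
  shows "\<exists>\<pi>. \<pi> permutes A \<and> (\<forall>i\<in>A'. \<pi> i = \<tau> i)"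
proof -
  have fin: "finite A'" using A finite_subset by blast
  have "card (A - A') = card (A - \<tau> ` A')"
    using A fin by (simp add: card_Diff_subset card_image)
  then obtain f where f: "bij_betw f (A - A') (A - \<tau> ` A')"
    using finite_same_card_bij[of "A - A'" "A - \<tau> ` A'"] A(1) by auto
  define \<pi> where "\<pi> i = (if i \<in> A' then \<tau> i else if i \<in> A then f i else i)" for i
  have "bij_betw \<pi> A' (\<tau> ` A')"
    using A(2) by (subst bij_betw_cong[of _ _ \<tau>]) (auto simp: \<pi>_def bij_betw_def)
  moreover have "bij_betw \<pi> (A - A') (A - \<tau> ` A')"
    using f by (subst bij_betw_cong[of _ _ f]) (auto simp: \<pi>_def)
  ultimately have "bij_betw \<pi> (A' \<union> (A - A')) (\<tau> ` A' \<union> (A - \<tau> ` A'))"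
    by (rule bij_betw_combine) auto
  moreover have "A' \<union> (A - A') = A" "\<tau> ` A' \<union> (A - \<tau> ` A') = A" using A by auto
  ultimately have "bij_betw \<pi> A A" by simp
  hence "\<pi> permutes A" using A(3) by (intro bij_imp_permutes) (auto simp: \<pi>_def)
  thus ?thesis by (intro exI[of _ \<pi>]) (auto simp: \<pi>_def)
qed

text \<open>
  Uniformity in the injection is what makes a group of permutations bounded. If it failed, one
  could delete from a bad vector the at most \<open>2 M\<close> coordinates that lie below \<open>M\<close> or are mapped
  there. Each costs at most a fixed multiple of the norm, because the basis vectors have
  comparable norms; so the rest is still bad, and it fits into a block beyond \<open>M\<close>.
\<close>
lemma symmetric_basis_injection_bound:
  fixes s :: "nat \<Rightarrow> 's::banach"
  assumes sym: "symmetric_basis s"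
  shows "\<exists>K>0. \<forall>A a \<tau>. finite A \<longrightarrow> inj_on \<tau> A \<longrightarrow>
      norm (\<Sum>i\<in>A. a i *\<^sub>R s (\<tau> i)) \<le> K * norm (\<Sum>i\<in>A. a i *\<^sub>R s i)"
proof (rule ccontr)
  assume "\<not> ?thesis"
  hence unb: "\<And>K. K > 0 \<Longrightarrow> \<exists>A a \<tau>. finite A \<and> inj_on \<tau> A \<and>
      norm (\<Sum>i\<in>A. a i *\<^sub>R s (\<tau> i)) > K * norm (\<Sum>i\<in>A. a i *\<^sub>R s i)"
    by (meson not_le)
  have basis: "schauder_basis s" using sym by (simp add: symmetric_basis_def)
  have pos: "norm (s i) > 0" for i using schauder_basis_nonzero[OF basis] by simp
  obtain C where C: "C > 0" "\<And>a i. summable (\<lambda>i. a i *\<^sub>R s i) \<Longrightarrow>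
        \<bar>a i\<bar> * norm (s i) \<le> C * norm (\<Sum>i. a i *\<^sub>R s i)"
    using basis_coeff_bound[OF basis] by blast
  obtain R where R: "\<And>i j. norm (s i) \<le> R * norm (s j)" using symmetric_basis_norm_ratio[OF sym] by blast
  have Rpos: "R > 0" using R[of 0 0] pos[of 0] by (smt (verit) mult_nonpos_nonneg)
  have coeff: "norm (a i *\<^sub>R s l) \<le> R * C * norm (\<Sum>i\<in>A. a i *\<^sub>R s i)"
    if "finite A" "i \<in> A" for A a i l
  proof -
    define b where "b i = (if i \<in> A then a i else 0)" for i
    have b: "(\<lambda>i. b i *\<^sub>R s i) sums (\<Sum>i\<in>A. b i *\<^sub>R s i)"
      by (rule finite_support_sums) (use that in \<open>auto simp: b_def\<close>)
    have eq: "(\<Sum>i\<in>A. b i *\<^sub>R s i) = (\<Sum>i\<in>A. a i *\<^sub>R s i)" by (intro sum.cong) (auto simp: b_def)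
    have "\<bar>a i\<bar> * norm (s i) \<le> C * norm (\<Sum>i\<in>A. a i *\<^sub>R s i)"
      using C(2)[OF sums_summable[OF b], of i] sums_unique[OF b] eq that by (simp add: b_def)
    hence "R * (\<bar>a i\<bar> * norm (s i)) \<le> R * (C * norm (\<Sum>i\<in>A. a i *\<^sub>R s i))" using Rpos by simp
    moreover have "norm (a i *\<^sub>R s l) \<le> \<bar>a i\<bar> * (R * norm (s i))" using R by (simp add: mult_left_mono)
    ultimately show ?thesis by (simp add: algebra_simps)
  qed
  show False
  proof (rule symmetric_basis_no_blocks[OF sym])
    fix M :: nat and e :: real assume e: "e > 0"
    \<comment> \<open>\<open>D\<close> bounds the cost of the deletion relative to the norm of the vector.\<close>
    define D where "D = 2 * real M * (R * C)"
    have D: "D \<ge> 0" using Rpos C by (simp add: D_def)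
    define K where "K = D + (1 + D) / e"
    have "(1 + D) / e > 0" using D e by (intro divide_pos_pos) auto
    hence K: "K > 0" using D unfolding K_def by linarith
    obtain A a \<tau> where A: "finite A" "inj_on \<tau> A"
      and big: "norm (\<Sum>i\<in>A. a i *\<^sub>R s (\<tau> i)) > K * norm (\<Sum>i\<in>A. a i *\<^sub>R s i)"
      using unb[OF K] by blast
    define nx where "nx = norm (\<Sum>i\<in>A. a i *\<^sub>R s i)"
    define A' where "A' = {i \<in> A. M \<le> i \<and> M \<le> \<tau> i}"
    have A'A: "A' \<subseteq> A" by (auto simp: A'_def)
    have card: "card (A - A') \<le> 2 * M"
    proof -
      have "A - A' \<subseteq> {..<M} \<union> {i \<in> A. \<tau> i < M}" by (auto simp: A'_def)
      hence "card (A - A') \<le> card ({..<M} \<union> {i \<in> A. \<tau> i < M})" using A by (intro card_mono) auto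
      also have "\<dots> \<le> card {..<M} + card {i \<in> A. \<tau> i < M}" by (rule card_Un_le)
      also have "card {i \<in> A. \<tau> i < M} \<le> card {..<M}"
        using A by (intro card_inj_on_le[of \<tau>]) (auto intro: inj_on_subset)
      finally show ?thesis by simp
    qed
    have rest: "norm (\<Sum>i\<in>A - A'. a i *\<^sub>R s (f i)) \<le> D * nx" for f
    proof -
      have "norm (\<Sum>i\<in>A - A'. a i *\<^sub>R s (f i)) \<le> (\<Sum>i\<in>A - A'. R * C * nx)"
        unfolding nx_def using A by (intro sum_norm_le coeff) auto
      also have "\<dots> = real (card (A - A')) * (R * C * nx)" by simp
      also have "\<dots> \<le> real (2 * M) * (R * C * nx)"
        using card Rpos C by (intro mult_right_mono) (auto simp: nx_def)
      finally show ?thesis by (simp add: D_def algebra_simps)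
    qed
    have split: "(\<Sum>i\<in>A'. a i *\<^sub>R s (f i)) = (\<Sum>i\<in>A. a i *\<^sub>R s (f i)) - (\<Sum>i\<in>A - A'. a i *\<^sub>R s (f i))" for f
      using sum.subset_diff[OF A'A A(1), of "\<lambda>i. a i *\<^sub>R s (f i)"] by simp
    have small': "norm (\<Sum>i\<in>A'. a i *\<^sub>R s i) \<le> nx + D * nx"
      using split[of id] rest[of id] norm_triangle_ineq4 unfolding nx_def by (smt (verit) id_apply sum.cong)
    define w where "w = norm (\<Sum>i\<in>A'. a i *\<^sub>R s (\<tau> i))"
    have "norm (\<Sum>i\<in>A. a i *\<^sub>R s (\<tau> i)) - norm (\<Sum>i\<in>A - A'. a i *\<^sub>R s (\<tau> i)) \<le> w"
      unfolding w_def split by (rule norm_triangle_ineq2)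
    hence w: "w > (K - D) * nx"
      using big rest[of \<tau>] unfolding nx_def[symmetric] left_diff_distrib by linarith
    have KD: "K - D = (1 + D) / e" by (simp add: K_def)
    have w0: "w > 0"
    proof -
      have "0 \<le> (K - D) * nx" unfolding KD using D e by (simp add: nx_def)
      thus ?thesis using w by linarith
    qed
    have "(1 + D) * nx = e * ((K - D) * nx)" unfolding KD using e by simp
    also have "\<dots> \<le> e * w" using w e by (intro mult_left_mono) auto
    finally have ew: "norm (\<Sum>i\<in>A'. a i *\<^sub>R s i) \<le> e * w" using small' by (simp add: distrib_right)
    define M' where "M' = Suc (Max (insert M (A' \<union> \<tau> ` A')))"
    have finA': "finite A'" using A A'A finite_subset by blast
    have le_M': "i < M'" if "i \<in> insert M (A' \<union> \<tau> ` A')" for i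
      unfolding M'_def less_Suc_eq_le using finA' that by (intro Max_ge) auto
    have sub: "A' \<subseteq> {M..<M'}" "\<tau> ` A' \<subseteq> {M..<M'}" using le_M' by (auto simp: A'_def)
    obtain \<pi> where \<pi>: "\<pi> permutes {M..<M'}" "\<And>i. i \<in> A' \<Longrightarrow> \<pi> i = \<tau> i"
      using inj_on_finite_extends_permutation[of "{M..<M'}" \<tau> A'] sub A A'A inj_on_subset by blast
    define b where "b i = (if i \<in> A' then a i / w else 0)" for i
    have b: "(\<Sum>i\<in>{M..<M'}. b i *\<^sub>R x i) = (1 / w) *\<^sub>R (\<Sum>i\<in>A'. a i *\<^sub>R x i)" for x :: "nat \<Rightarrow> 's"
    proof -
      have "(\<Sum>i\<in>{M..<M'}. b i *\<^sub>R x i) = (\<Sum>i\<in>A'. b i *\<^sub>R x i)"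
        using sub by (intro sum.mono_neutral_right) (auto simp: b_def)
      also have "\<dots> = (\<Sum>i\<in>A'. (1 / w) *\<^sub>R (a i *\<^sub>R x i))" by (intro sum.cong) (auto simp: b_def)
      finally show ?thesis by (simp add: scaleR_sum_right)
    qed
    have "(\<Sum>i\<in>A'. a i *\<^sub>R s (\<pi> i)) = (\<Sum>i\<in>A'. a i *\<^sub>R s (\<tau> i))" using \<pi> by (intro sum.cong) auto
    hence "norm (\<Sum>i\<in>{M..<M'}. b i *\<^sub>R s (\<pi> i)) = 1" using w0 unfolding b by (simp add: w_def)
    moreover have "norm (\<Sum>i\<in>{M..<M'}. b i *\<^sub>R s i) \<le> e" using w0 ew unfolding b by (simp add: field_simps)
    moreover have "M < M'" using le_M' by simp
    ultimately show "\<exists>M'>M. \<exists>a \<pi>. \<pi> permutes {M..<M'} \<and>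
        norm (\<Sum>i\<in>{M..<M'}. a i *\<^sub>R s i) \<le> e \<and> norm (\<Sum>i\<in>{M..<M'}. a i *\<^sub>R s (\<pi> i)) \<ge> 1"
      using \<pi>(1) by (metis order_refl)
  qed
qed

text \<open>
  Symmetry entails unconditionality: to project onto \<open>A\<close>, shift the coordinates outside \<open>A\<close> beyond
  all of \<open>B\<close> by an injection, and then cut them off by a partial sum.
\<close>
lemma symmetric_basis_subset_injection_bound:
  fixes s :: "nat \<Rightarrow> 's::banach"
  assumes sym: "symmetric_basis s"
  shows "\<exists>K>0. \<forall>A B a \<tau>. finite B \<longrightarrow> A \<subseteq> B \<longrightarrow> inj_on \<tau> A \<longrightarrow>
      norm (\<Sum>i\<in>A. a i *\<^sub>R s (\<tau> i)) \<le> K * norm (\<Sum>i\<in>B. a i *\<^sub>R s i)"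
proof -
  have basis: "schauder_basis s" using sym by (simp add: symmetric_basis_def)
  obtain K where K: "K > 0" "\<And>A a \<tau>. finite A \<Longrightarrow> inj_on \<tau> A \<Longrightarrow>
      norm (\<Sum>i\<in>A. a i *\<^sub>R s (\<tau> i)) \<le> K * norm (\<Sum>i\<in>A. a i *\<^sub>R s i)"
    using symmetric_basis_injection_bound[OF sym] by blast
  obtain C where C: "C > 0" "\<And>a n. summable (\<lambda>i. a i *\<^sub>R s i) \<Longrightarrow>
           norm (\<Sum>i<n. a i *\<^sub>R s i) \<le> C * norm (\<Sum>i. a i *\<^sub>R s i)"
    using basis_constant[OF basis] by blast
  have proj: "norm (\<Sum>i\<in>A. a i *\<^sub>R s i) \<le> C * K * norm (\<Sum>i\<in>B. a i *\<^sub>R s i)"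
    if B: "finite B" "A \<subseteq> B" for A B a
  proof -
    define M where "M = Suc (Max (insert 0 B))"
    have less_M: "i < M" if "i \<in> B" for i
      unfolding M_def less_Suc_eq_le using B that by (intro Max_ge) auto
    define \<tau> where "\<tau> i = (if i \<in> A then i else i + M)" for i
    define W where "W = A \<union> (\<lambda>i. i + M) ` (B - A)"
    define b where "b k = (if k \<in> A then a k else if k \<in> W then a (k - M) else 0)" for k
    have fin: "finite A" "finite W" using B finite_subset by (auto simp: W_def)
    have inj: "inj_on \<tau> B" using less_M B by (auto simp: inj_on_def \<tau>_def)
    have disj: "A \<inter> (\<lambda>i. i + M) ` (B - A) = {}" using less_M B by fastforce
    have sums: "(\<lambda>i. b i *\<^sub>R s i) sums (\<Sum>i\<in>W. b i *\<^sub>R s i)"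
      by (rule finite_support_sums) (use fin in \<open>auto simp: b_def W_def\<close>)
    have "(\<Sum>i\<in>W. b i *\<^sub>R s i) = (\<Sum>i\<in>A. b i *\<^sub>R s i) + (\<Sum>i\<in>(\<lambda>i. i + M) ` (B - A). b i *\<^sub>R s i)"
      unfolding W_def using fin B disj by (intro sum.union_disjoint) auto
    also have "(\<Sum>i\<in>A. b i *\<^sub>R s i) = (\<Sum>i\<in>A. a i *\<^sub>R s (\<tau> i))" by (intro sum.cong) (auto simp: b_def \<tau>_def)
    also have "(\<Sum>i\<in>(\<lambda>i. i + M) ` (B - A). b i *\<^sub>R s i) = (\<Sum>i\<in>B - A. b (i + M) *\<^sub>R s (i + M))"
      by (subst sum.reindex) (auto simp: inj_on_def)
    also have "\<dots> = (\<Sum>i\<in>B - A. a i *\<^sub>R s (\<tau> i))"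
      using disj by (intro sum.cong) (auto simp: b_def \<tau>_def W_def)
    also have "(\<Sum>i\<in>A. a i *\<^sub>R s (\<tau> i)) + (\<Sum>i\<in>B - A. a i *\<^sub>R s (\<tau> i)) = (\<Sum>i\<in>B. a i *\<^sub>R s (\<tau> i))"
      using sum.subset_diff[OF B(2,1), of "\<lambda>i. a i *\<^sub>R s (\<tau> i)"] by (simp add: add.commute)
    finally have W: "(\<Sum>i\<in>W. b i *\<^sub>R s i) = (\<Sum>i\<in>B. a i *\<^sub>R s (\<tau> i))" .
    have "(\<Sum>i<M. b i *\<^sub>R s i) = (\<Sum>i\<in>A. b i *\<^sub>R s i)"
    proof (rule sum.mono_neutral_right)
      show "A \<subseteq> {..<M}" using B less_M by auto
      show "\<forall>i\<in>{..<M} - A. b i *\<^sub>R s i = 0" by (auto simp: b_def W_def)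
    qed simp
    also have "\<dots> = (\<Sum>i\<in>A. a i *\<^sub>R s i)" by (intro sum.cong) (auto simp: b_def)
    finally have "norm (\<Sum>i\<in>A. a i *\<^sub>R s i) \<le> C * norm (\<Sum>i\<in>B. a i *\<^sub>R s (\<tau> i))"
      using C(2)[OF sums_summable[OF sums], of M] sums_unique[OF sums] W by simp
    also have "\<dots> \<le> C * (K * norm (\<Sum>i\<in>B. a i *\<^sub>R s i))"
      using K(2)[OF B(1) inj, of a] C(1) by (intro mult_left_mono) auto
    finally show ?thesis by simp
  qed
  have "norm (\<Sum>i\<in>A. a i *\<^sub>R s (\<tau> i)) \<le> K * (C * K) * norm (\<Sum>i\<in>B. a i *\<^sub>R s i)"
    if "finite B" "A \<subseteq> B" "inj_on \<tau> A" for A B a \<tau>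
  proof -
    have "finite A" using that finite_subset by blast
    hence "norm (\<Sum>i\<in>A. a i *\<^sub>R s (\<tau> i)) \<le> K * norm (\<Sum>i\<in>A. a i *\<^sub>R s i)" using K(2) that by blast
    also have "\<dots> \<le> K * (C * K * norm (\<Sum>i\<in>B. a i *\<^sub>R s i))"
      using proj that K(1) by (intro mult_left_mono) auto
    finally show ?thesis by (simp add: mult.assoc)
  qed
  thus ?thesis using K C by (intro exI[of _ "K * (C * K)"]) auto
qed

text \<open>
  Permuting the coefficients is a bounded operation, with a bound that does not depend on the
  permutation. A section of the permuted series is a sum over a finite set with an injection
  applied to the basis vectors, and it is dominated by a section of the given series.
\<close>
theorem symmetric_basis_rearrangement:
  fixes s :: "nat \<Rightarrow> 's::banach"
  assumes sym: "symmetric_basis s"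
  shows "\<exists>L>0. \<forall>a \<pi>. bij \<pi> \<longrightarrow> summable (\<lambda>n. a n *\<^sub>R s n) \<longrightarrow> summable (\<lambda>n. a (\<pi> n) *\<^sub>R s n) \<and>
      norm (\<Sum>n. a (\<pi> n) *\<^sub>R s n) \<le> L * norm (\<Sum>n. a n *\<^sub>R s n)"
proof -
  have basis: "schauder_basis s" using sym by (simp add: symmetric_basis_def)
  obtain K where K: "K > 0" "\<And>A B a \<tau>. finite B \<Longrightarrow> A \<subseteq> B \<Longrightarrow> inj_on \<tau> A \<Longrightarrow>
      norm (\<Sum>i\<in>A. a i *\<^sub>R s (\<tau> i)) \<le> K * norm (\<Sum>i\<in>B. a i *\<^sub>R s i)"
    using symmetric_basis_subset_injection_bound[OF sym] by blast
  obtain C where C: "C > 0" "\<And>a n. summable (\<lambda>i. a i *\<^sub>R s i) \<Longrightarrow>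
           norm (\<Sum>i<n. a i *\<^sub>R s i) \<le> C * norm (\<Sum>i. a i *\<^sub>R s i)"
    using basis_constant[OF basis] by blast
  have "summable (\<lambda>n. a (\<pi> n) *\<^sub>R s n) \<and>
      norm (\<Sum>n. a (\<pi> n) *\<^sub>R s n) \<le> (K * C) * norm (\<Sum>n. a n *\<^sub>R s n)"
    if bij: "bij \<pi>" and a: "summable (\<lambda>n. a n *\<^sub>R s n)" for a \<pi>
  proof -
    have inv: "inv_into UNIV \<pi> (\<pi> n) = n" for n using bij by (simp add: bij_is_inj)
    have inj: "inj_on \<pi> A" for A by (rule inj_on_subset[OF bij_is_inj[OF bij]]) simp
    have inj': "inj_on (inv_into UNIV \<pi>) A" for A
      using bij_is_inj[OF bij_imp_bij_inv[OF bij]] by (rule inj_on_subset) simp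
    have bound: "norm (\<Sum>n\<in>I. a (\<pi> n) *\<^sub>R s n) \<le> K * norm (\<Sum>i\<in>B. a i *\<^sub>R s i)"
      if "finite B" "\<pi> ` I \<subseteq> B" for I B
    proof -
      have "(\<Sum>n\<in>I. a (\<pi> n) *\<^sub>R s n) = (\<Sum>i\<in>\<pi> ` I. a i *\<^sub>R s (inv_into UNIV \<pi> i))"
        by (subst sum.reindex[OF inj]) (simp add: inv)
      thus ?thesis using K(2)[OF that inj'] by simp
    qed
    have sm: "summable (\<lambda>n. a (\<pi> n) *\<^sub>R s n)"
      unfolding summable_Cauchy
    proof (intro allI impI)
      fix e :: real assume e: "e > 0"
      then obtain M where M: "\<And>p q. p \<ge> M \<Longrightarrow> norm (\<Sum>i\<in>{p..<q}. a i *\<^sub>R s i) < e / K"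
        using a K(1) unfolding summable_Cauchy by (metis divide_pos_pos)
      have "finite (inv_into UNIV \<pi> ` {..<M})" by simp
      then obtain n0 where n0: "\<And>k. k \<in> inv_into UNIV \<pi> ` {..<M} \<Longrightarrow> k < n0"
        using finite_nat_set_iff_bounded by metis
      have far: "\<pi> k \<ge> M" if "k \<ge> n0" for k
      proof (rule ccontr)
        assume "\<not> \<pi> k \<ge> M"
        hence "inv_into UNIV \<pi> (\<pi> k) \<in> inv_into UNIV \<pi> ` {..<M}" by auto
        thus False using n0[of k] that by (simp add: inv)
      qed
      have "norm (\<Sum>k\<in>{m..<n}. a (\<pi> k) *\<^sub>R s k) < e" if m: "m \<ge> n0" for m n
      proof -
        define q where "q = Suc (Max (insert M (\<pi> ` {m..<n})))"
        have "i < q" if "i \<in> \<pi> ` {m..<n}" for i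
          unfolding q_def less_Suc_eq_le using that by (intro Max_ge) auto
        hence "\<pi> ` {m..<n} \<subseteq> {M..<q}" using far m by auto
        hence "norm (\<Sum>k\<in>{m..<n}. a (\<pi> k) *\<^sub>R s k) \<le> K * norm (\<Sum>i\<in>{M..<q}. a i *\<^sub>R s i)"
          by (intro bound) auto
        also have "\<dots> < K * (e / K)" using M[of M q] K(1) by (intro mult_strict_left_mono) auto
        finally show ?thesis using K(1) by simp
      qed
      thus "\<exists>N. \<forall>m\<ge>N. \<forall>n. norm (\<Sum>k\<in>{m..<n}. a (\<pi> k) *\<^sub>R s k) < e" by blast
    qed
    have part: "norm (\<Sum>k<n. a (\<pi> k) *\<^sub>R s k) \<le> (K * C) * norm (\<Sum>n. a n *\<^sub>R s n)" for n
    proof -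
      define q where "q = Suc (Max (insert 0 (\<pi> ` {..<n})))"
      have "i < q" if "i \<in> \<pi> ` {..<n}" for i
        unfolding q_def less_Suc_eq_le using that by (intro Max_ge) auto
      hence "norm (\<Sum>k<n. a (\<pi> k) *\<^sub>R s k) \<le> K * norm (\<Sum>i<q. a i *\<^sub>R s i)" by (intro bound) auto
      also have "\<dots> \<le> K * (C * norm (\<Sum>n. a n *\<^sub>R s n))" using C(2)[OF a] K(1) by (intro mult_left_mono) auto
      finally show ?thesis by simp
    qed
    have "norm (\<Sum>n. a (\<pi> n) *\<^sub>R s n) \<le> (K * C) * norm (\<Sum>n. a n *\<^sub>R s n)"
      by (rule LIMSEQ_le_const2[OF tendsto_norm[OF summable_LIMSEQ[OF sm]]]) (use part in auto)
    thus ?thesis using sm by blast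
  qed
  thus ?thesis using K C by (intro exI[of _ "K * C"]) auto
qed

text \<open>
  As the basis vectors are bounded away from zero, the coefficients are uniformly controlled by
  the norm and tend to zero.
\<close>
theorem symmetric_basis_coeff_bound:
  fixes s :: "nat \<Rightarrow> 's::banach"
  assumes sym: "symmetric_basis s"
  shows "\<exists>L>0. \<forall>a. summable (\<lambda>n. a n *\<^sub>R s n) \<longrightarrow>
     (\<forall>i. \<bar>a i\<bar> \<le> L * norm (\<Sum>n. a n *\<^sub>R s n)) \<and> a \<longlonglongrightarrow> 0"
proof -
  have basis: "schauder_basis s" using sym by (simp add: symmetric_basis_def)
  have pos: "norm (s i) > 0" for i using schauder_basis_nonzero[OF basis] by simp
  obtain C where C: "C > 0" "\<And>a i. summable (\<lambda>i. a i *\<^sub>R s i) \<Longrightarrow>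
        \<bar>a i\<bar> * norm (s i) \<le> C * norm (\<Sum>i. a i *\<^sub>R s i)"
    using basis_coeff_bound[OF basis] by blast
  obtain R where R: "\<And>i j. norm (s i) \<le> R * norm (s j)" using symmetric_basis_norm_ratio[OF sym] by blast
  have Rpos: "R > 0" using R[of 0 0] pos[of 0] by (smt (verit) mult_nonpos_nonneg)
  have key: "\<bar>c\<bar> \<le> R / norm (s 0) * (\<bar>c\<bar> * norm (s i))" for c i
  proof -
    have "\<bar>c\<bar> * norm (s 0) \<le> \<bar>c\<bar> * (R * norm (s i))" using R by (intro mult_left_mono) auto
    thus ?thesis using pos[of 0] by (simp add: field_simps)
  qed
  define L where "L = R / norm (s 0) * C"
  have "(\<forall>i. \<bar>a i\<bar> \<le> L * norm (\<Sum>n. a n *\<^sub>R s n)) \<and> a \<longlonglongrightarrow> 0" if a: "summable (\<lambda>n. a n *\<^sub>R s n)" for a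
  proof
    show "\<forall>i. \<bar>a i\<bar> \<le> L * norm (\<Sum>n. a n *\<^sub>R s n)"
    proof
      fix i
      have "R / norm (s 0) * (\<bar>a i\<bar> * norm (s i)) \<le> R / norm (s 0) * (C * norm (\<Sum>n. a n *\<^sub>R s n))"
        using C(2)[OF a, of i] Rpos pos[of 0] by (intro mult_left_mono) auto
      thus "\<bar>a i\<bar> \<le> L * norm (\<Sum>n. a n *\<^sub>R s n)" using key[of "a i" i] by (simp add: L_def mult.assoc)
    qed
    have "(\<lambda>n. R / norm (s 0) * norm (a n *\<^sub>R s n)) \<longlonglongrightarrow> R / norm (s 0) * norm (0 :: 's)"
      by (intro tendsto_intros summable_LIMSEQ_zero[OF a])
    hence "(\<lambda>n. R / norm (s 0) * (\<bar>a n\<bar> * norm (s n))) \<longlonglongrightarrow> 0" by simp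
    thus "a \<longlonglongrightarrow> 0"
      by (rule Lim_null_comparison[rotated]) (use key in auto)
  qed
  moreover have "L > 0" using Rpos pos[of 0] C by (simp add: L_def)
  ultimately show ?thesis by blast
qed

section \<open>A norm with prescribed isometries\<close>

text \<open>
  A linear functional with a local minimum is zero.
\<close>
lemma linear_eq_of_local_le:
  fixes f g :: "'x::real_vector \<Rightarrow> real"
  assumes lin: "linear f" "linear g" and p: "is_norm p" and r: "r > 0"
    and eq: "f x = g x" and le: "\<And>y. p (y - x) < r \<Longrightarrow> f y \<le> g y"
  shows "f = g"
proof
  fix w
  define t where "t = r / 2 / (p w + 1)"
  have pw: "p w \<ge> 0" using p by (simp add: is_norm_def)
  have t: "t > 0" using r pw by (simp add: t_def)
  have "p w + 1 \<noteq> 0" using pw by linarith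
  hence "t * (p w + 1) = r / 2" by (metis nonzero_eq_divide_eq t_def)
  hence "t * p w < r" using t r by (simp add: distrib_left)
  hence "p (t *\<^sub>R w) < r" "p ((-t) *\<^sub>R w) < r" using p t by (simp_all add: is_norm_def del: scaleR_minus_left)
  hence "f (x + t *\<^sub>R w) \<le> g (x + t *\<^sub>R w)" "f (x + (-t) *\<^sub>R w) \<le> g (x + (-t) *\<^sub>R w)"
    by (intro le; simp del: scaleR_minus_left)+
  hence "t * f w \<le> t * g w" "(-t) * f w \<le> (-t) * g w"
    using eq lin by (simp_all add: linear_add linear_scale linear_diff)
  thus "f w = g w" using t by auto
qed

text \<open>
  The data for the renorming. The functional \<open>\<phi>\<close> and the vector \<open>z\<close> tell apart the elements of the
  group: the orbit of \<open>z\<close> meets the set where \<open>\<phi>\<close> does not vanish only in \<open>z\<close> and \<open>- z\<close>. The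
  functionals \<open>\<sigma> n\<close> vanish at \<open>z\<close>, are triangular with respect to the vectors \<open>v n\<close>, and separate
  points together with \<open>\<phi>\<close>. That \<open>\<phi>\<close> and \<open>\<sigma> 0\<close> tend to zero along every orbit makes the suprema
  below attained.
\<close>
locale signed_action = group G for G :: "('g, 'm) monoid_scheme" (structure) +
  fixes j :: 'g and \<rho> :: "'g \<Rightarrow> 'x::real_vector \<Rightarrow> 'x" and p :: "'x \<Rightarrow> real" and R :: real
    and \<phi> :: "'x \<Rightarrow> real" and \<sigma> :: "nat \<Rightarrow> 'x \<Rightarrow> real" and z :: 'x and v :: "nat \<Rightarrow> 'x"
  assumes j_in: "j \<in> carrier G"
    and rho_linear: "g \<in> carrier G \<Longrightarrow> linear (\<rho> g)"
    and rho_one: "\<rho> \<one> x = x"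
    and rho_mult: "g \<in> carrier G \<Longrightarrow> h \<in> carrier G \<Longrightarrow> \<rho> (g \<otimes> h) x = \<rho> g (\<rho> h x)"
    and rho_j: "\<rho> j x = - x"
    and p_norm: "is_norm p"
    and p_rho: "g \<in> carrier G \<Longrightarrow> p (\<rho> g x) = p x"
    and R_pos: "R > 0"
    and phi_linear: "linear \<phi>" and phi_le: "\<bar>\<phi> x\<bar> \<le> R * p x"
    and sigma_linear: "linear (\<sigma> n)" and sigma_le: "\<bar>\<sigma> n x\<bar> \<le> p x"
    and phi_z: "\<phi> z = 1" and sigma_z: "\<sigma> n z = 0" and p_z: "p z \<le> 1/4"
    and phi_rho_z: "g \<in> carrier G \<Longrightarrow> g \<noteq> \<one> \<Longrightarrow> g \<noteq> j \<Longrightarrow> \<phi> (\<rho> g z) = 0"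
    and phi_v: "\<phi> (v n) = 0" and sigma_v: "\<sigma> n (v n) = 1"
    and sigma_v_less: "m < n \<Longrightarrow> \<sigma> m (v n) = 0"
    and total: "\<phi> x = 0 \<Longrightarrow> (\<And>n. \<sigma> n x = 0) \<Longrightarrow> x = 0"
    and phi_vanishes: "e > 0 \<Longrightarrow> finite {g \<in> carrier G. e \<le> \<bar>\<phi> (\<rho> g x)\<bar>}"
    and sigma_vanishes: "e > 0 \<Longrightarrow> finite {g \<in> carrier G. e \<le> \<bar>\<sigma> 0 (\<rho> g x)\<bar>}"
begin

lemma p_nonneg [simp]: "0 \<le> p x" and p_scale: "p (a *\<^sub>R x) = \<bar>a\<bar> * p x"
  and p_triangle: "p (x + y) \<le> p x + p y" and p_eq_0 [simp]: "p x = 0 \<longleftrightarrow> x = 0"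
  using p_norm by (auto simp: is_norm_def)

lemma p_0 [simp]: "p 0 = 0"
  by simp

lemma p_minus [simp]: "p (- x) = p x"
  using p_scale[of "-1" x] by simp

text \<open>
  The weights decrease so fast that \<open>d m\<close> beats the size of \<open>v n\<close> for all \<open>n < m\<close>. The constant
  \<open>R + 2\<close> is the one that compares the new norm with \<open>p\<close>.
\<close>
definition d :: "nat \<Rightarrow> real" where
  "d n = 1 / (4 * (\<Prod>l<n. 2 * (1 + (R + 2) * p (v l))))"

lemma d_quotient_ge_2: "2 * (1 + (R + 2) * p (v l)) \<ge> 2"
  using R_pos by simp

lemma d_pos [simp]: "d n > 0"
proof -
  have "(\<Prod>l<n. 2 * (1 + (R + 2) * p (v l))) > 0"
    using d_quotient_ge_2 by (intro prod_pos) (smt (verit))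
  thus ?thesis by (simp add: d_def)
qed

lemma d_Suc: "d (Suc n) * (2 * (1 + (R + 2) * p (v n))) = d n"
proof -
  have "2 * (1 + (R + 2) * p (v n)) \<noteq> 0" using d_quotient_ge_2[of n] by linarith
  thus ?thesis unfolding d_def prod.lessThan_Suc by (simp add: divide_simps)
qed

lemma d_Suc_le: "d (Suc n) \<le> d n / 2"
proof -
  have "d (Suc n) * 2 \<le> d (Suc n) * (2 * (1 + (R + 2) * p (v n)))"
    using d_quotient_ge_2[of n] by (intro mult_left_mono) (auto simp: less_imp_le)
  thus ?thesis unfolding d_Suc by linarith
qed

lemma d_decreasing: "m \<le> n \<Longrightarrow> d n \<le> d m"
proof (induction rule: dec_induct)
  case (step n)
  thus ?case using d_Suc_le[of n] d_pos[of n] by linarith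
qed simp

lemma d_le_power: "d n \<le> (1/2) ^ n / 4"
proof (induction n)
  case 0 show ?case by (simp add: d_def)
next
  case (Suc n) thus ?case using d_Suc_le[of n] by simp
qed

lemma d_le: "d n \<le> 1/4"
  using d_decreasing[of 0 n] d_le_power[of 0] by simp

lemma d_tendsto_0: "d \<longlonglongrightarrow> 0"
proof (rule tendsto_sandwich)
  show "eventually (\<lambda>n. 0 \<le> d n) sequentially" by (simp add: less_imp_le)
  show "eventually (\<lambda>n. d n \<le> (1/2) ^ n / 4) sequentially" using d_le_power by (intro always_eventually allI)
  have "(\<lambda>n. (1/2::real) ^ n / 4) \<longlonglongrightarrow> 0 / 4" by (intro tendsto_divide LIMSEQ_realpow_zero) auto
  thus "(\<lambda>n. (1/2::real) ^ n / 4) \<longlonglongrightarrow> 0" by simp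
qed auto

lemma d_rapid: "n < m \<Longrightarrow> d m * ((R + 2) * p (v n)) < d n / 2"
proof -
  assume "n < m"
  hence "d m * ((R + 2) * p (v n)) \<le> d (Suc n) * ((R + 2) * p (v n))"
    using R_pos by (intro mult_right_mono d_decreasing) auto
  also have "\<dots> = d n / 2 - d (Suc n)" using d_Suc[of n] by (simp add: algebra_simps)
  finally show ?thesis using d_pos[of "Suc n"] by linarith
qed

text \<open>
  A sequence of functionals that converges to its zeroth member \<open>\<phi>\<close> in norm, at a speed that
  identifies each of them.
\<close>
definition \<eta> :: "nat \<Rightarrow> 'x \<Rightarrow> real" where
  "\<eta> k x = (case k of 0 \<Rightarrow> \<phi> x | Suc n \<Rightarrow> \<phi> x + d n * \<sigma> n x)"

lemma eta_0 [simp]: "\<eta> 0 x = \<phi> x" and eta_Suc [simp]: "\<eta> (Suc n) x = \<phi> x + d n * \<sigma> n x"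
  by (simp_all add: \<eta>_def)

lemma d_sigma_le: "\<bar>d n * \<sigma> n x\<bar> \<le> p x / 4"
proof -
  have "\<bar>d n * \<sigma> n x\<bar> \<le> 1/4 * p x"
    unfolding abs_mult using sigma_le d_le d_pos[of n] by (intro mult_mono) (auto simp: less_imp_le)
  thus ?thesis by simp
qed

lemma eta_linear: "linear (\<eta> k)"
proof (cases k)
  case 0 thus ?thesis using phi_linear by (simp add: \<eta>_def[abs_def])
next
  case (Suc n)
  have "\<eta> k = (\<lambda>x. \<phi> x + d n *\<^sub>R \<sigma> n x)" by (simp add: Suc fun_eq_iff)
  thus ?thesis using phi_linear sigma_linear[of n]
    by (simp only: linear_compose_add linear_compose_scale_right)
qed

lemma eta_near_phi: "\<bar>\<eta> k x - \<phi> x\<bar> \<le> p x / 4"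
  by (cases k) (auto simp: d_sigma_le[simplified] abs_mult[symmetric])

lemma eta_le: "\<bar>\<eta> k x\<bar> \<le> (R + 2) * p x"
  using eta_near_phi[of k x] phi_le[of x] p_nonneg[of x] unfolding distrib_right by linarith

lemma eta_rho_z:
  assumes "g \<in> carrier G" "g \<noteq> \<one>" "g \<noteq> j" shows "\<bar>\<eta> k (\<rho> g z)\<bar> \<le> 1/16"
  using eta_near_phi[of k "\<rho> g z"] p_rho[of g z] p_z phi_rho_z assms by simp

lemma eta_z [simp]: "\<eta> k z = 1"
  by (cases k) (auto simp: phi_z sigma_z)

lemma eta_minus: "\<eta> k (- x) = - \<eta> k x"
  using linear_neg[OF eta_linear] by blast

text \<open>
  The two additional squares prevent the round part from being linear in any open set.
\<close>

definition round_part :: "'x \<Rightarrow> real" where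
  "round_part x = sqrt ((p x)\<^sup>2 + ((\<phi> x)\<^sup>2 + (\<sigma> 0 x)\<^sup>2) / (R + 1)\<^sup>2)"

lemma round_part_sq: "(round_part x)\<^sup>2 = (p x)\<^sup>2 + ((\<phi> x)\<^sup>2 + (\<sigma> 0 x)\<^sup>2) / (R + 1)\<^sup>2"
  unfolding round_part_def by (intro real_sqrt_pow2 add_nonneg_nonneg divide_nonneg_nonneg) auto

lemma round_part_nonneg [simp]: "0 \<le> round_part x"
  unfolding round_part_def by (simp add: add_nonneg_nonneg)

lemma p_le_round_part: "p x \<le> round_part x"
  by (rule power2_le_imp_le) (auto simp: round_part_sq)

lemma round_part_le: "round_part x \<le> 2 * p x"
proof (rule power2_le_imp_le)
  have "(\<phi> x)\<^sup>2 \<le> (R * p x)\<^sup>2" "(\<sigma> 0 x)\<^sup>2 \<le> (p x)\<^sup>2"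
    using phi_le[of x] sigma_le[of 0 x] by (metis abs_le_square_iff abs_of_nonneg abs_ge_zero order_trans power2_abs power_mono)+
  hence "(\<phi> x)\<^sup>2 + (\<sigma> 0 x)\<^sup>2 \<le> (R\<^sup>2 + 1) * (p x)\<^sup>2" by (simp add: algebra_simps power_mult_distrib)
  also have "\<dots> \<le> (R + 1)\<^sup>2 * (p x)\<^sup>2"
    using R_pos by (intro mult_right_mono) (auto simp: power2_eq_square algebra_simps)
  finally have "((\<phi> x)\<^sup>2 + (\<sigma> 0 x)\<^sup>2) / (R + 1)\<^sup>2 \<le> (p x)\<^sup>2"
    using R_pos by (simp add: divide_simps mult.commute)
  moreover have "(2 * p x)\<^sup>2 = 4 * (p x)\<^sup>2" by (simp add: power_mult_distrib)
  ultimately show "(round_part x)\<^sup>2 \<le> (2 * p x)\<^sup>2" unfolding round_part_sq using zero_le_power2[of "p x"] by linarith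
qed simp

lemma round_part_triangle: "round_part (x + y) \<le> round_part x + round_part y"
proof -
  define c where "c = 1 / (R + 1)"
  define L where "L x = (p x, c * \<phi> x, c * \<sigma> 0 x)" for x
  have round_part: "round_part x = norm (L x)" for x
    by (simp add: L_def round_part_def norm_Pair c_def power_divide add_divide_distrib)
  have L: "L x + L y = (p x + p y, c * \<phi> (x + y), c * \<sigma> 0 (x + y))"
    using phi_linear sigma_linear[of 0] by (simp add: L_def linear_add algebra_simps)
  have "round_part (x + y) \<le> norm (L x + L y)"
    unfolding round_part L by (auto simp: L_def norm_Pair intro!: power_mono p_triangle)
  also have "\<dots> \<le> round_part x + round_part y" unfolding round_part by (rule norm_triangle_ineq)
  finally show ?thesis .
qed

lemma round_part_scale: "round_part (a *\<^sub>R x) = \<bar>a\<bar> * round_part x"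
proof -
  have "(round_part (a *\<^sub>R x))\<^sup>2 = (\<bar>a\<bar> * round_part x)\<^sup>2"
    unfolding round_part_sq power_mult_distrib p_scale
    using phi_linear sigma_linear[of 0]
    by (simp add: linear_scale power_mult_distrib algebra_simps add_divide_distrib)
  thus ?thesis by (simp add: power2_eq_iff_nonneg)
qed

text \<open>
  The norm \<open>p\<close> contributes by convexity, the two squares by the parallelogram identity.
\<close>
lemma round_part_parallelogram:
  "2 * (round_part x)\<^sup>2 + 2 * ((\<phi> w)\<^sup>2 + (\<sigma> 0 w)\<^sup>2) / (R + 1)\<^sup>2 \<le> (round_part (x + w))\<^sup>2 + (round_part (x - w))\<^sup>2"
proof -
  have "2 * p x = p ((x + w) + (x - w))" using p_scale[of 2 x] by (simp add: scaleR_2)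
  also have "\<dots> \<le> p (x + w) + p (x - w)" by (rule p_triangle)
  finally have "(2 * p x)\<^sup>2 \<le> (p (x + w) + p (x - w))\<^sup>2" by (intro power_mono) auto
  also have "\<dots> \<le> 2 * ((p (x + w))\<^sup>2 + (p (x - w))\<^sup>2)"
    using zero_le_power2[of "p (x + w) - p (x - w)"] by (simp add: power2_eq_square algebra_simps)
  finally have 1: "2 * (p x)\<^sup>2 \<le> (p (x + w))\<^sup>2 + (p (x - w))\<^sup>2" by (simp add: power_mult_distrib)
  have 2: "(f (x + w))\<^sup>2 + (f (x - w))\<^sup>2 = 2 * (f x)\<^sup>2 + 2 * (f w)\<^sup>2" if "linear f" for f :: "'x \<Rightarrow> real"
    using that by (simp add: linear_add linear_diff power2_eq_square algebra_simps)
  have "(\<phi> (x + w))\<^sup>2 + (\<sigma> 0 (x + w))\<^sup>2 + ((\<phi> (x - w))\<^sup>2 + (\<sigma> 0 (x - w))\<^sup>2)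
      = 2 * ((\<phi> x)\<^sup>2 + (\<sigma> 0 x)\<^sup>2) + 2 * ((\<phi> w)\<^sup>2 + (\<sigma> 0 w)\<^sup>2)"
    using 2[OF phi_linear] 2[OF sigma_linear[of 0]] by simp
  hence "((\<phi> (x + w))\<^sup>2 + (\<sigma> 0 (x + w))\<^sup>2) / (R + 1)\<^sup>2 + ((\<phi> (x - w))\<^sup>2 + (\<sigma> 0 (x - w))\<^sup>2) / (R + 1)\<^sup>2
      = 2 * (((\<phi> x)\<^sup>2 + (\<sigma> 0 x)\<^sup>2) / (R + 1)\<^sup>2) + 2 * ((\<phi> w)\<^sup>2 + (\<sigma> 0 w)\<^sup>2) / (R + 1)\<^sup>2"
    by (simp add: add_divide_distrib[symmetric])
  thus ?thesis unfolding round_part_sq using 1 by (simp add: algebra_simps)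
qed

definition piece :: "nat \<Rightarrow> 'x \<Rightarrow> real" where
  "piece k x = (case k of 0 \<Rightarrow> round_part x | Suc i \<Rightarrow> \<bar>\<eta> i x\<bar>)"

lemma piece_0 [simp]: "piece 0 x = round_part x" and piece_Suc [simp]: "piece (Suc i) x = \<bar>\<eta> i x\<bar>"
  by (simp_all add: piece_def)

lemma piece_le: "piece k x \<le> (R + 2) * p x"
proof (cases k)
  case 0
  have "2 * p x \<le> (R + 2) * p x" using R_pos by (intro mult_right_mono) auto
  thus ?thesis using 0 round_part_le[of x] by simp
qed (use eta_le in auto)

lemma piece_triangle: "piece k (x + y) \<le> piece k x + piece k y"
  by (cases k) (use round_part_triangle linear_add[OF eta_linear] in auto)

lemma piece_scale: "piece k (a *\<^sub>R x) = \<bar>a\<bar> * piece k x"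
  by (cases k) (use round_part_scale linear_scale[OF eta_linear] in \<open>auto simp: abs_mult\<close>)

lemma piece_lipschitz: "piece k y \<le> piece k x + (R + 2) * p (y - x)"
  using piece_triangle[of k x "y - x"] piece_le[of k "y - x"] by simp

text \<open>
  The unit ball of the new norm is an intersection of round balls, one for each group element,
  cut by the slabs \<open>\<bar>\<eta> k (\<rho> g x)\<bar> \<le> 1\<close>.
\<close>
definition N :: "'x \<Rightarrow> real" where
  "N x = (SUP (g, k) \<in> carrier G \<times> UNIV. piece k (\<rho> g x))"

lemma piece_rho_le: "g \<in> carrier G \<Longrightarrow> piece k (\<rho> g x) \<le> (R + 2) * p x"
  using piece_le[of k "\<rho> g x"] p_rho[of g x] by simp

lemma N_bdd: "bdd_above ((\<lambda>(g, k). piece k (\<rho> g x)) ` (carrier G \<times> UNIV))"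
  by (rule bdd_aboveI[of _ "(R + 2) * p x"]) (auto intro: piece_rho_le)

lemma piece_le_N: "g \<in> carrier G \<Longrightarrow> piece k (\<rho> g x) \<le> N x"
  unfolding N_def using cSUP_upper[OF _ N_bdd, of "(g, k)" x] by auto

lemma N_le: "(\<And>g k. g \<in> carrier G \<Longrightarrow> piece k (\<rho> g x) \<le> c) \<Longrightarrow> N x \<le> c"
  unfolding N_def by (rule cSUP_least) auto

lemma p_le_N: "p x \<le> N x"
  using piece_le_N[of \<one> 0 x] p_le_round_part[of x] by (simp add: rho_one)

lemma N_le_p: "N x \<le> (R + 2) * p x"
  by (intro N_le piece_rho_le)

lemma N_is_norm: "is_norm N"
  unfolding is_norm_def
proof (intro conjI allI)
  fix x y :: 'x and a :: real
  show "0 \<le> N x" using p_le_N[of x] p_nonneg[of x] by linarith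
  show "N x = 0 \<longleftrightarrow> x = 0"
    using p_le_N[of x] N_le_p[of x] p_nonneg[of x] p_eq_0[of x] by (metis mult_zero_right order_antisym)
  show "N (x + y) \<le> N x + N y"
  proof (rule N_le)
    fix g k assume g: "g \<in> carrier G"
    show "piece k (\<rho> g (x + y)) \<le> N x + N y"
      using piece_triangle[of k "\<rho> g x" "\<rho> g y"] piece_le_N[OF g, of k] rho_linear[OF g]
      by (simp add: linear_add) (smt (verit))
  qed
  have le: "N (a *\<^sub>R x) \<le> \<bar>a\<bar> * N x" for a x
  proof (rule N_le)
    fix g k assume g: "g \<in> carrier G"
    show "piece k (\<rho> g (a *\<^sub>R x)) \<le> \<bar>a\<bar> * N x"
      using piece_le_N[OF g, of k x] rho_linear[OF g]
      by (simp add: linear_scale piece_scale mult_left_mono)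
  qed
  show "N (a *\<^sub>R x) = \<bar>a\<bar> * N x"
  proof (cases "a = 0")
    case True thus ?thesis using le[of 0 x] p_le_N[of 0] by simp
  next
    case False
    have "N x \<le> \<bar>inverse a\<bar> * N (a *\<^sub>R x)" using le[of "inverse a" "a *\<^sub>R x"] False by simp
    hence "\<bar>a\<bar> * N x \<le> N (a *\<^sub>R x)" using False by (simp add: field_simps)
    thus ?thesis using le[of a x] by simp
  qed
qed

lemma N_rho:
  assumes h: "h \<in> carrier G" shows "N (\<rho> h x) = N x"
proof -
  have le: "N (\<rho> h x) \<le> N x" if h: "h \<in> carrier G" for h x
    by (rule N_le) (metis piece_le_N h m_closed rho_mult)
  have "N x = N (\<rho> (inv h) (\<rho> h x))"
    using h by (simp add: rho_mult[symmetric] rho_one)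
  also have "\<dots> \<le> N (\<rho> h x)" using h by (intro le) auto
  finally show ?thesis using le[OF h, of x] by simp
qed

text \<open>
  For a fixed group element the functionals \<open>\<eta> k\<close> converge to \<open>\<eta> 0\<close>, so a supremum over \<open>k\<close> that is
  not attained would be approached by \<open>\<bar>\<phi> (\<rho> g x)\<bar>\<close>, which belongs to the family. All but
  finitely many group elements stay below the supremum by a fixed amount.
\<close>
lemma N_attained: "\<exists>g\<in>carrier G. \<exists>k. N x = piece k (\<rho> g x)"
proof (rule ccontr)
  assume "\<not> ?thesis"
  hence less: "piece k (\<rho> g x) < N x" if "g \<in> carrier G" for g k
    using piece_le_N[OF that, of k x] that by (metis order_le_less)
  define s where "s = N x"
  have ps: "p x < s"
    using less[of \<one> 0] p_le_round_part[of x] by (simp add: rho_one s_def)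
  hence s: "s > 0" using p_nonneg[of x] by linarith
  have bound: "\<exists>t<s. \<forall>k. piece k (\<rho> g x) \<le> t" if g: "g \<in> carrier G" for g
  proof -
    define y where "y = \<rho> g x"
    have lim: "(\<lambda>n. \<bar>\<phi> y\<bar> + d n * p y) \<longlonglongrightarrow> \<bar>\<phi> y\<bar> + 0 * p y"
      by (intro tendsto_intros d_tendsto_0)
    have phi: "\<bar>\<phi> y\<bar> < s" using less[OF g, of "Suc 0"] by (simp add: y_def s_def)
    then obtain t where t: "\<bar>\<phi> y\<bar> < t" "t < s" using dense by blast
    obtain n0 where n0: "\<bar>\<phi> y\<bar> + d n * p y < t" if "n \<ge> n0" for n
      using order_tendstoD(2)[OF lim, of t] t by (auto simp: eventually_sequentially)
    define M where "M = Max ((\<lambda>k. piece k y) ` {..n0 + 2})"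
    have "M < s" unfolding M_def using less[OF g] by (subst Max_less_iff) (auto simp: y_def s_def)
    moreover have "piece k y \<le> max M t" for k
    proof (cases "k \<le> n0 + 2")
      case True thus ?thesis unfolding M_def by (intro max.coboundedI1 Max_ge) auto
    next
      case False
      then obtain n where k: "k = Suc (Suc n)" and n: "n \<ge> n0"
        by (metis add_2_eq_Suc' nat_le_linear not_less_eq_eq old.nat.exhaust Suc_le_mono le0)
      have "\<bar>d n * \<sigma> n y\<bar> \<le> d n * p y"
        unfolding abs_mult using sigma_le[of n y] by (simp add: less_imp_le mult_left_mono)
      hence "piece k y \<le> \<bar>\<phi> y\<bar> + d n * p y" by (simp add: k)
      thus ?thesis using n0[OF n] by simp
    qed
    ultimately show ?thesis using t by (intro exI[of _ "max M t"]) (auto simp: y_def)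
  qed
  then obtain t where t: "\<And>g. g \<in> carrier G \<Longrightarrow> t g < s" "\<And>g k. g \<in> carrier G \<Longrightarrow> piece k (\<rho> g x) \<le> t g"
    by metis
  \<comment> \<open>Squares below \<open>e\<close> raise the square of the round part by at most half of the distance
    between the squares of \<open>p x\<close> and \<open>s\<close>.\<close>
  define e where "e = (R + 1)\<^sup>2 * (s\<^sup>2 - (p x)\<^sup>2) / 4"
  have "s\<^sup>2 > (p x)\<^sup>2" using ps by (intro power_strict_mono) auto
  hence e: "e > 0" using R_pos by (simp add: e_def)
  define A where "A = {g \<in> carrier G. s / 4 \<le> \<bar>\<phi> (\<rho> g x)\<bar>} \<union> {g \<in> carrier G. sqrt e \<le> \<bar>\<phi> (\<rho> g x)\<bar>}
    \<union> {g \<in> carrier G. sqrt e \<le> \<bar>\<sigma> 0 (\<rho> g x)\<bar>}"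
  have fA: "finite A" unfolding A_def using s e by (intro finite_UnI phi_vanishes sigma_vanishes) auto
  define B where "B = sqrt (((p x)\<^sup>2 + s\<^sup>2) / 2)"
  have "B < sqrt (s\<^sup>2)" unfolding B_def using \<open>s\<^sup>2 > (p x)\<^sup>2\<close> by (subst real_sqrt_less_iff) simp
  hence B: "B < s" using s by simp
  define T where "T = Max (insert B (insert (s / 2) (t ` A)))"
  have "T < s" unfolding T_def using fA B s t(1) by (subst Max_less_iff) (auto simp: A_def)
  moreover have "N x \<le> T"
  proof (rule N_le)
    fix g k assume g: "g \<in> carrier G"
    show "piece k (\<rho> g x) \<le> T"
    proof (cases "g \<in> A")
      case True
      hence "t g \<le> T" unfolding T_def using fA by (intro Max_ge) auto
      thus ?thesis using t(2)[OF g, of k] by linarith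
    next
      case False
      define y where "y = \<rho> g x"
      have small: "\<bar>\<phi> y\<bar> < s / 4" "\<bar>\<phi> y\<bar> < sqrt e" "\<bar>\<sigma> 0 y\<bar> < sqrt e"
        using False g by (auto simp: A_def y_def not_le)
      have py: "p y = p x" using p_rho[OF g] by (simp add: y_def)
      have BT: "B \<le> T" "s / 2 \<le> T" unfolding T_def by (rule Max_ge, use fA in simp, simp)+
      show ?thesis
      proof (cases k)
        case 0
        have "(\<phi> y)\<^sup>2 < e" "(\<sigma> 0 y)\<^sup>2 < e"
          using small(2,3) e by (metis real_less_rsqrt real_sqrt_abs real_sqrt_less_iff)+
        hence "((\<phi> y)\<^sup>2 + (\<sigma> 0 y)\<^sup>2) / (R + 1)\<^sup>2 \<le> (2 * e) / (R + 1)\<^sup>2"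
          by (intro divide_right_mono) auto
        also have "\<dots> = (s\<^sup>2 - (p x)\<^sup>2) / 2" using R_pos by (simp add: e_def)
        finally have "round_part y \<le> B"
          unfolding round_part_def B_def py by (simp add: field_simps)
        thus ?thesis using BT 0 by (simp add: y_def)
      next
        case (Suc i)
        have "\<bar>\<eta> i y\<bar> \<le> \<bar>\<phi> y\<bar> + p y / 4" using eta_near_phi[of i y] by linarith
        also have "\<dots> \<le> s / 2" using small ps py by simp
        finally show ?thesis using Suc BT by (simp add: y_def)
      qed
    qed
  qed
  ultimately show False by (simp add: s_def)
qed

text \<open>
  The functionals that describe the flat parts of the unit sphere. Isometries permute them.
\<close>
definition flat :: "('x \<Rightarrow> real) \<Rightarrow> bool" where
  "flat f \<longleftrightarrow> linear f \<and> (\<exists>x. \<exists>r>0. \<forall>y. p (y - x) < r \<longrightarrow> N y = f y)"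

text \<open>
  Take a piece that attains the norm at a point of the flat part. If it is a slab, then its
  functional lies below the linear functional \<open>f\<close> nearby and agrees with it at the point, so the
  two coincide. If it is round, then \<open>f\<close> is constant in the directions of its kernel, and the
  parallelogram inequality forces \<open>\<phi>\<close> and \<open>\<sigma> 0\<close> to vanish on a hyperplane; but they are linearly
  independent.
\<close>
lemma flat_imp_eta:
  assumes "flat f" shows "\<exists>g\<in>carrier G. \<exists>k. f = \<eta> k \<circ> \<rho> g"
proof -
  obtain x r where f: "linear f" and r: "r > 0" and eq: "\<And>y. p (y - x) < r \<Longrightarrow> N y = f y"
    using assms unfolding flat_def by blast
  have Nx: "N x = f x" using eq[of x] r by simp
  obtain g k where g: "g \<in> carrier G" and at: "N x = piece k (\<rho> g x)" using N_attained by blast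
  have lin: "linear (\<eta> i \<circ> \<rho> h)" if "h \<in> carrier G" for i h
    using eta_linear rho_linear[OF that] linear_compose by blast
  show ?thesis
  proof (cases k)
    case (Suc i)
    show ?thesis
    proof (cases "\<eta> i (\<rho> g x) \<ge> 0")
      case True
      have "\<eta> i \<circ> \<rho> g = f"
      proof (rule linear_eq_of_local_le[OF lin[OF g] f p_norm r])
        show "(\<eta> i \<circ> \<rho> g) x = f x" using at Suc Nx True by simp
        fix y assume "p (y - x) < r"
        thus "(\<eta> i \<circ> \<rho> g) y \<le> f y" using piece_le_N[OF g, of "Suc i" y] eq[of y] by simp
      qed
      thus ?thesis using g by blast
    next
      case False
      have gj: "j \<otimes> g \<in> carrier G" using g j_in by blast
      have minus: "\<eta> i (\<rho> (j \<otimes> g) y) = - \<eta> i (\<rho> g y)" for y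
        using g j_in by (simp add: rho_mult rho_j eta_minus)
      have "\<eta> i \<circ> \<rho> (j \<otimes> g) = f"
      proof (rule linear_eq_of_local_le[OF lin[OF gj] f p_norm r])
        show "(\<eta> i \<circ> \<rho> (j \<otimes> g)) x = f x" using at Suc Nx False by (simp add: minus)
        fix y assume "p (y - x) < r"
        thus "(\<eta> i \<circ> \<rho> (j \<otimes> g)) y \<le> f y" using piece_le_N[OF g, of "Suc i" y] eq[of y] by (simp add: minus)
      qed
      thus ?thesis using gj by blast
    qed
  next
    case 0
    define a where "a = \<rho> (inv g) z"
    define b where "b = \<rho> (inv g) (v 0)"
    have ab: "\<rho> g a = z" "\<rho> g b = v 0"
      using g by (simp_all add: a_def b_def rho_mult[symmetric] rho_one)
    \<comment> \<open>A vector in the kernel of \<open>f\<close> that lies in the plane spanned by \<open>a\<close> and \<open>b\<close>.\<close>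
    define w where "w = (if f a = 0 then a else f b *\<^sub>R a - f a *\<^sub>R b)"
    have fw: "f w = 0" using f by (simp add: w_def linear_diff linear_scale)
    have gw: "\<rho> g w = (if f a = 0 then z else f b *\<^sub>R z - f a *\<^sub>R v 0)"
      using rho_linear[OF g] by (simp add: w_def linear_diff linear_scale ab)
    have pos: "(\<phi> (\<rho> g w))\<^sup>2 + (\<sigma> 0 (\<rho> g w))\<^sup>2 > 0"
    proof (cases "f a = 0")
      case True thus ?thesis by (simp add: gw phi_z sigma_z)
    next
      case False
      have "\<sigma> 0 (\<rho> g w) = - f a"
        using sigma_linear[of 0] False by (simp add: gw linear_diff linear_scale sigma_z sigma_v)
      thus ?thesis using False by (simp add: add_nonneg_pos)
    qed
    define t where "t = r / 2 / (p w + 1)"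
    have t: "t > 0" using r by (simp add: t_def add_nonneg_pos)
    have "p w + 1 \<noteq> 0" using p_nonneg[of w] by linarith
    hence "t * (p w + 1) = r / 2" by (metis nonzero_eq_divide_eq t_def)
    hence "t * p w < r" using t r by (simp add: distrib_left)
    hence pt: "p (t *\<^sub>R w) < r" using t by (simp add: p_scale)
    have near: "N (x + t *\<^sub>R w) = f x" "N (x - t *\<^sub>R w) = f x"
      using eq[of "x + t *\<^sub>R w"] eq[of "x - t *\<^sub>R w"] pt f fw by (simp_all add: linear_add linear_diff linear_scale)
    let ?y = "\<rho> g x" and ?w = "t *\<^sub>R \<rho> g w"
    have "round_part (?y + ?w) \<le> f x" "round_part (?y - ?w) \<le> f x"
      using piece_le_N[OF g, of 0 "x + t *\<^sub>R w"] piece_le_N[OF g, of 0 "x - t *\<^sub>R w"] near rho_linear[OF g]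
      by (simp_all add: linear_add linear_diff linear_scale)
    moreover have "f x = round_part ?y" using at 0 Nx by simp
    ultimately have "(round_part (?y + ?w))\<^sup>2 \<le> (round_part ?y)\<^sup>2" "(round_part (?y - ?w))\<^sup>2 \<le> (round_part ?y)\<^sup>2"
      by (simp_all only: power_mono round_part_nonneg)
    hence "2 * ((\<phi> ?w)\<^sup>2 + (\<sigma> 0 ?w)\<^sup>2) / (R + 1)\<^sup>2 \<le> 0"
      using round_part_parallelogram[of ?y ?w] by linarith
    moreover have "(\<phi> ?w)\<^sup>2 + (\<sigma> 0 ?w)\<^sup>2 = t\<^sup>2 * ((\<phi> (\<rho> g w))\<^sup>2 + (\<sigma> 0 (\<rho> g w))\<^sup>2)"
      using phi_linear sigma_linear[of 0] by (simp add: linear_scale power_mult_distrib algebra_simps)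
    hence "(\<phi> ?w)\<^sup>2 + (\<sigma> 0 ?w)\<^sup>2 > 0" using pos t by simp
    hence "2 * ((\<phi> ?w)\<^sup>2 + (\<sigma> 0 ?w)\<^sup>2) / (R + 1)\<^sup>2 > 0" using R_pos by (intro divide_pos_pos) auto
    ultimately show ?thesis by linarith
  qed
qed

text \<open>
  Each slab \<open>\<eta> (Suc n)\<close> really cuts off a flat part, around \<open>z + s v n\<close> with small \<open>s\<close>. There
  \<open>\<phi>\<close> is 1, and \<open>\<eta> (Suc n)\<close> exceeds it by \<open>s d n\<close>; earlier functionals give exactly 1, later
  ones at most half of that excess by the choice of the weights, the round part is small because
  \<open>p z\<close> is, and group elements other than 1 and \<open>j\<close> move \<open>z\<close> into the kernel of \<open>\<phi>\<close>.
\<close>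
lemma flat_eta_Suc: "flat (\<eta> (Suc n))"
proof -
  \<comment> \<open>This \<open>s\<close> makes \<open>(R + 2) * p (s v n)\<close> at most 1/16.\<close>
  define c where "c = (R + 2) * (p (v n) + 1)"
  define s where "s = 1 / (16 * c)"
  have "1 * 1 \<le> (R + 2) * (p (v n) + 1)" using R_pos by (intro mult_mono) auto
  hence c: "c \<ge> 1" by (simp add: c_def)
  hence sc: "s * c = 1 / 16" and s0: "s > 0" by (simp_all add: s_def)
  have "s * 1 \<le> s * c" using s0 c by (intro mult_left_mono) auto
  hence s: "s > 0" "s \<le> 1/16" using s0 sc by simp_all
  have "s * ((R + 2) * p (v n)) \<le> s * c"
    using s0 R_pos by (intro mult_left_mono) (auto simp: c_def algebra_simps)
  hence Rsv: "(R + 2) * (s * p (v n)) \<le> 1 / 16" using sc by (simp add: mult.left_commute)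
  have "0 \<le> s * p (v n)" using s by simp
  moreover from this have "0 \<le> R * (s * p (v n))" using R_pos by simp
  ultimately have sv: "s * p (v n) \<le> 1 / 16" using Rsv unfolding distrib_right by linarith
  define x where "x = z + s *\<^sub>R v n"
  define gap where "gap = s * d n / 2"
  have gap: "gap > 0" "gap \<le> 1/32"
  proof -
    show "gap > 0" using s by (simp add: gap_def)
    have "s * d n \<le> 1/16 * (1/4)" using s d_le[of n] d_pos[of n] by (intro mult_mono) (auto simp: less_imp_le)
    thus "gap \<le> 1/32" by (simp add: gap_def)
  qed
  have psv: "p (s *\<^sub>R v n) \<le> 1/16" using s sv by (simp add: p_scale)
  have px: "p x \<le> 5/16" using p_triangle[of z "s *\<^sub>R v n"] p_z psv by (simp add: x_def)
  have phi_x: "\<phi> x = 1" using phi_linear by (simp add: x_def linear_add linear_scale phi_z phi_v)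
  have sigma_x: "\<sigma> m x = s * \<sigma> m (v n)" for m
    using sigma_linear[of m] by (simp add: x_def linear_add linear_scale sigma_z)
  have top: "\<eta> (Suc n) x = 1 + 2 * gap" by (simp add: phi_x sigma_x sigma_v gap_def)
  have other: "piece k (\<rho> g x) \<le> 1 + gap"
    if g: "g \<in> carrier G" and ne: "\<not> (k = Suc (Suc n) \<and> (g = \<one> \<or> g = j))" for g k
  proof (cases k)
    case 0
    have "round_part (\<rho> g x) \<le> 2 * p x" using round_part_le[of "\<rho> g x"] p_rho[OF g] by simp
    thus ?thesis using 0 px gap by simp
  next
    case k: (Suc i)
    show ?thesis
    proof (cases "g = \<one> \<or> g = j")
      case True
      hence abs: "piece k (\<rho> g x) = \<bar>\<eta> i x\<bar>" using k by (auto simp: rho_one rho_j eta_minus)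
      show ?thesis
      proof (cases i)
        case 0 thus ?thesis using abs phi_x gap by simp
      next
        case i: (Suc m)
        have "m \<noteq> n" using True ne k i by auto
        have eta: "\<eta> i x = 1 + s * (d m * \<sigma> m (v n))" by (simp add: i phi_x sigma_x)
        have "\<bar>s * (d m * \<sigma> m (v n))\<bar> \<le> gap"
        proof (cases "m < n")
          case True thus ?thesis using gap by (simp add: sigma_v_less)
        next
          case False
          hence "n < m" using \<open>m \<noteq> n\<close> by simp
          have "\<bar>d m * \<sigma> m (v n)\<bar> \<le> d m * p (v n)"
            unfolding abs_mult using sigma_le[of m "v n"] by (simp add: less_imp_le)
          also have "\<dots> \<le> d m * ((R + 2) * p (v n))"
          proof -
            have "1 * p (v n) \<le> (R + 2) * p (v n)" using R_pos by (intro mult_right_mono) auto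
            thus ?thesis using d_pos[of m] by (intro mult_left_mono) (auto simp: less_imp_le)
          qed
          also have "\<dots> \<le> d n / 2" using d_rapid[OF \<open>n < m\<close>] by simp
          finally have "s * \<bar>d m * \<sigma> m (v n)\<bar> \<le> s * (d n / 2)" using s by (intro mult_left_mono) auto
          thus ?thesis using s by (simp add: gap_def abs_mult)
        qed
        thus ?thesis unfolding abs eta using gap by linarith
      qed
    next
      case False
      have "\<rho> g x = \<rho> g z + s *\<^sub>R \<rho> g (v n)"
        using rho_linear[OF g] by (simp add: x_def linear_add linear_scale)
      hence eta: "\<eta> i (\<rho> g x) = \<eta> i (\<rho> g z) + \<eta> i (s *\<^sub>R \<rho> g (v n))"
        using linear_add[OF eta_linear] by simp
      have "\<bar>\<eta> i (s *\<^sub>R \<rho> g (v n))\<bar> \<le> (R + 2) * (s * p (v n))"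
        using eta_le[of i "s *\<^sub>R \<rho> g (v n)"] s p_rho[OF g] by (simp add: p_scale)
      hence "\<bar>\<eta> i (s *\<^sub>R \<rho> g (v n))\<bar> \<le> 1/16" using Rsv by linarith
      moreover have "\<bar>\<eta> i (\<rho> g z)\<bar> \<le> 1/16" using eta_rho_z[OF g] False by blast
      ultimately show ?thesis using k gap eta by simp
    qed
  qed
  define r where "r = gap / 2 / (R + 2)"
  have r: "r > 0" using gap R_pos by (simp add: r_def)
  have "N y = \<eta> (Suc n) y" if y: "p (y - x) < r" for y
  proof -
    have "(R + 2) * p (y - x) \<le> (R + 2) * r" using y R_pos by (intro mult_left_mono) auto
    also have "(R + 2) * r = gap / 2"
    proof -
      have "R + 2 \<noteq> 0" using R_pos by simp
      thus ?thesis by (metis nonzero_eq_divide_eq r_def mult.commute)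
    qed
    finally have close: "(R + 2) * p (y - x) \<le> gap / 2" .
    have "\<bar>\<eta> (Suc n) y - \<eta> (Suc n) x\<bar> \<le> gap / 2"
      using close eta_le[of "Suc n" "y - x"] linear_diff[OF eta_linear, of "Suc n" y x] by (simp del: eta_Suc)
    hence low: "\<eta> (Suc n) y \<ge> 1 + 3/2 * gap" using top by linarith
    show ?thesis
    proof (rule antisym)
      show "N y \<le> \<eta> (Suc n) y"
      proof (rule N_le)
        fix g k assume g: "g \<in> carrier G"
        show "piece k (\<rho> g y) \<le> \<eta> (Suc n) y"
        proof (cases "k = Suc (Suc n) \<and> (g = \<one> \<or> g = j)")
          case True
          hence "piece k (\<rho> g y) = \<bar>\<eta> (Suc n) y\<bar>" by (auto simp: rho_one rho_j eta_minus simp del: eta_Suc)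
          thus ?thesis using low gap by linarith
        next
          case False
          have "p (\<rho> g y - \<rho> g x) = p (y - x)"
            using rho_linear[OF g] p_rho[OF g] by (metis linear_diff)
          hence "piece k (\<rho> g y) \<le> piece k (\<rho> g x) + gap / 2"
            using piece_lipschitz[of k "\<rho> g y" "\<rho> g x"] close by simp
          thus ?thesis using other[OF g False] low by linarith
        qed
      qed
      have "\<bar>\<eta> (Suc n) y\<bar> \<le> N y" using piece_le_N[of \<one> "Suc (Suc n)" y] by (simp add: rho_one del: eta_Suc)
      thus "\<eta> (Suc n) y \<le> N y" by linarith
    qed
  qed
  thus ?thesis unfolding flat_def using eta_linear r by blast
qed

lemma flat_comp:
  assumes f: "flat f" and T: "linear T" "surj T" "\<And>x. N (T x) = N x"
  shows "flat (f \<circ> T)"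
proof -
  obtain x r where lf: "linear f" and r: "r > 0" and eq: "\<And>y. p (y - x) < r \<Longrightarrow> N y = f y"
    using f unfolding flat_def by blast
  obtain x' where x': "T x' = x" using T(2) by (metis surjD)
  have "N y = (f \<circ> T) y" if y: "p (y - x') < r / (R + 2)" for y
  proof -
    have "p (T y - x) \<le> N (T (y - x'))" using p_le_N[of "T (y - x')"] T(1) x' by (simp add: linear_diff)
    also have "\<dots> \<le> (R + 2) * p (y - x')" using N_le_p[of "y - x'"] T(3) by simp
    also have "\<dots> < r" using y R_pos by (simp add: pos_less_divide_eq mult.commute)
    finally show ?thesis using eq[of "T y"] T(3) by simp
  qed
  moreover have "r / (R + 2) > 0" using r R_pos by simp
  ultimately show ?thesis unfolding flat_def using linear_compose[OF T(1) lf] by blast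
qed

lemma N_z_le: "N z \<le> 1"
proof (rule N_le)
  fix g k assume g: "g \<in> carrier G"
  show "piece k (\<rho> g z) \<le> 1"
  proof (cases k)
    case 0
    have "round_part (\<rho> g z) \<le> 2 * p z" using round_part_le[of "\<rho> g z"] p_rho[OF g] by simp
    thus ?thesis using 0 p_z by simp
  next
    case (Suc i)
    show ?thesis
    proof (cases "g = \<one> \<or> g = j")
      case True thus ?thesis using Suc by (auto simp: rho_one rho_j eta_minus)
    next
      case False thus ?thesis using eta_rho_z[OF g, of i] Suc by auto
    qed
  qed
qed

text \<open>
  Functionals from translates by different group elements are far apart: one of them is 1 at a
  point of the orbit of \<open>z\<close> where the other is negative or small.
\<close>
lemma eta_orbits_separated:
  assumes g: "g \<in> carrier G" and h: "h \<in> carrier G"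
    and close: "\<And>x. \<bar>\<eta> k (\<rho> g x) - \<eta> l (\<rho> h x)\<bar> \<le> N x / 2"
  shows "g = h"
proof (rule ccontr)
  assume "g \<noteq> h"
  define f where "f = h \<otimes> inv g"
  have f: "f \<in> carrier G" using g h by (simp add: f_def)
  have f1: "f \<noteq> \<one>"
  proof
    assume "f = \<one>"
    hence "h = inv (inv g)" using g h inv_equality[of h "inv g"] by (simp add: f_def)
    thus False using \<open>g \<noteq> h\<close> g by simp
  qed
  let ?x = "\<rho> (inv g) z"
  have gx: "\<rho> g ?x = z" and hx: "\<rho> h ?x = \<rho> f z" and Nx: "N ?x = N z"
    using g h N_rho by (simp_all add: rho_mult[symmetric] rho_one f_def)
  have "\<bar>1 - \<eta> l (\<rho> f z)\<bar> \<le> 1 / 2"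
    using close[of ?x] N_z_le by (simp add: gx hx Nx)
  moreover have "\<eta> l (\<rho> f z) \<le> 1/16"
  proof (cases "f = j")
    case True thus ?thesis by (simp add: rho_j eta_minus)
  next
    case False thus ?thesis using eta_rho_z[OF f f1 False, of l] by linarith
  qed
  ultimately show False by linarith
qed

text \<open>
  An isometry \<open>T\<close> maps each \<open>\<eta> (Suc n)\<close> to a translate of some \<open>\<eta> (k n)\<close>. As the \<open>\<eta> n\<close> are close to
  each other, separation yields the same group element for all \<open>n\<close>; dividing it out gives an
  isometry \<open>S\<close>. Since \<open>k\<close> is injective, \<open>S\<close> fixes the limit \<open>\<phi>\<close>. The distance of \<open>\<eta> (Suc n)\<close> to
  \<open>\<phi>\<close> is preserved and determines \<open>n\<close>, hence \<open>S\<close> fixes every \<open>\<sigma> n\<close>, and by totality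
  every vector.
\<close>
lemma isometry_in_action:
  assumes T: "linear T" "surj T" "\<And>x. N (T x) = N x"
  shows "\<exists>g\<in>carrier G. T = \<rho> g"
proof -
  have "\<exists>g\<in>carrier G. \<exists>k. \<eta> (Suc n) \<circ> T = \<eta> k \<circ> \<rho> g" for n
    by (intro flat_imp_eta flat_comp flat_eta_Suc T)
  then obtain g k where g: "\<And>n. g n \<in> carrier G" and "\<And>n. \<eta> (Suc n) \<circ> T = \<eta> (k n) \<circ> \<rho> (g n)"
    by metis
  hence gk: "\<eta> (Suc n) (T x) = \<eta> (k n) (\<rho> (g n) x)" for n x
    by (metis comp_apply)
  have same: "g n = g 0" for n
  proof (rule eta_orbits_separated[OF g g])
    fix x
    have "\<bar>\<eta> (Suc n) (T x) - \<eta> (Suc 0) (T x)\<bar> \<le> p (T x) / 2"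
      using eta_near_phi[of "Suc n" "T x"] eta_near_phi[of "Suc 0" "T x"] by linarith
    also have "\<dots> \<le> N x / 2" using p_le_N[of "T x"] T(3) by simp
    finally show "\<bar>\<eta> (k n) (\<rho> (g n) x) - \<eta> (k 0) (\<rho> (g 0) x)\<bar> \<le> N x / 2" by (simp only: gk)
  qed
  define S where "S x = T (\<rho> (inv (g 0)) x)" for x
  have ig: "inv (g 0) \<in> carrier G" using g by simp
  have S_eta: "\<eta> (Suc n) (S x) = \<eta> (k n) x" for n x
    using g ig by (simp add: S_def gk same[of n] rho_mult[symmetric] rho_one del: eta_Suc)
  have NS: "N (S x) = N x" for x using N_rho[OF ig] T(3) by (simp add: S_def)
  have surj: "\<exists>x. S x = y" for y
  proof -
    obtain x where "T x = y" using T(2) by (metis surjD)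
    hence "S (\<rho> (g 0) x) = y" using g ig by (simp add: S_def rho_mult[symmetric] rho_one)
    thus ?thesis by blast
  qed
  \<comment> \<open>For \<open>m > n\<close> and on vectors of the same norm as \<open>v n\<close>, the functional \<open>d m \<sigma> m\<close> stays below
    the value \<open>d n\<close> that \<open>d n \<sigma> n\<close> takes at \<open>v n\<close>.\<close>
  have d_less: "d m * \<bar>\<sigma> m y\<bar> < d n" if "n < m" "N y = N (v n)" for m n y
  proof -
    have "d m * \<bar>\<sigma> m y\<bar> \<le> d m * ((R + 2) * p (v n))"
      using sigma_le[of m y] p_le_N[of y] N_le_p[of "v n"] that(2) d_pos[of m]
      by (intro mult_left_mono) (auto simp: less_imp_le)
    thus ?thesis using d_rapid[OF that(1)] d_pos[of n] by linarith
  qed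
  have inj: "inj k"
  proof (rule linorder_injI)
    fix n m :: nat assume "n < m"
    show "k n \<noteq> k m"
    proof
      assume "k n = k m"
      hence eq: "\<eta> (Suc n) (S x) = \<eta> (Suc m) (S x)" for x by (simp only: S_eta)
      obtain x where x: "S x = v n" using surj by blast
      have "d n = d m * \<sigma> m (v n)" using eq[of x] by (simp add: x phi_v sigma_v)
      moreover have "d m * \<sigma> m (v n) \<le> d m * \<bar>\<sigma> m (v n)\<bar>"
        by (intro mult_left_mono) (auto simp: less_imp_le)
      ultimately show False using d_less[OF \<open>n < m\<close>, of "v n"] by simp
    qed
  qed
  have phi_S: "\<phi> (S x) = \<phi> x" for x
  proof -
    have d_sigma: "(\<lambda>n. d n * \<sigma> n y) \<longlonglongrightarrow> 0" for y
    proof (rule Lim_null_comparison)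
      show "(\<lambda>n. d n * p y) \<longlonglongrightarrow> 0"
        using tendsto_mult_right[OF d_tendsto_0, of "p y"] by simp
      show "eventually (\<lambda>n. norm (d n * \<sigma> n y) \<le> d n * p y) sequentially"
        using sigma_le by (intro always_eventually allI) (simp add: abs_mult less_imp_le)
    qed
    have eta_lim: "(\<lambda>n. \<eta> n y) \<longlonglongrightarrow> \<phi> y" for y
    proof -
      have "(\<lambda>n. \<phi> y + d n * \<sigma> n y) \<longlonglongrightarrow> \<phi> y + 0" by (intro tendsto_intros d_sigma)
      hence "(\<lambda>n. \<eta> (Suc n) y) \<longlonglongrightarrow> \<phi> y" by simp
      thus ?thesis by (rule LIMSEQ_imp_Suc)
    qed
    have "filterlim k sequentially sequentially"
      unfolding filterlim_at_top
    proof
      fix Z :: nat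
      have "finite (k -` {..<Z})" by (rule finite_vimageI[OF _ inj]) simp
      moreover have "k -` {..<Z} = {n. \<not> Z \<le> k n}" by auto
      ultimately show "eventually (\<lambda>n. Z \<le> k n) sequentially"
        unfolding cofinite_eq_sequentially[symmetric] eventually_cofinite by simp
    qed
    hence "(\<lambda>n. \<eta> (k n) x) \<longlonglongrightarrow> \<phi> x" using filterlim_compose[OF eta_lim] by blast
    moreover have "(\<lambda>n. \<eta> (k n) x) \<longlonglongrightarrow> \<phi> (S x)"
      using LIMSEQ_Suc[OF eta_lim[of "S x"]] by (simp only: S_eta)
    ultimately show ?thesis using LIMSEQ_unique by blast
  qed
  have k: "k n = Suc n" for n
  proof (cases "k n")
    case 0
    obtain x where x: "S x = v n" using surj by blast
    have "d n * \<sigma> n (S x) = 0" using S_eta[of n x] 0 phi_S[of x] by simp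
    thus ?thesis using d_pos[of n] by (simp add: x sigma_v)
  next
    case (Suc m)
    have eq: "d n * \<sigma> n (S x) = d m * \<sigma> m x" for x
      using S_eta[of n x] Suc phi_S[of x] by simp
    consider "n < m" | "m < n" | "m = n" by linarith
    thus ?thesis
    proof cases
      case 1
      obtain x where x: "S x = v n" using surj by blast
      have "d m * \<bar>\<sigma> m x\<bar> < d n" using d_less[OF 1, of x] NS[of x] x by simp
      moreover have "d n = d m * \<sigma> m x" using eq[of x] by (simp add: x sigma_v)
      moreover have "d m * \<sigma> m x \<le> d m * \<bar>\<sigma> m x\<bar>" by (intro mult_left_mono) (auto simp: less_imp_le)
      ultimately show ?thesis by linarith
    next
      case 2
      have "d n * \<bar>\<sigma> n (S (v m))\<bar> < d m" using d_less[OF 2, of "S (v m)"] NS by simp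
      moreover have "d n * \<sigma> n (S (v m)) = d m" using eq[of "v m"] by (simp add: sigma_v)
      moreover have "d n * \<sigma> n (S (v m)) \<le> d n * \<bar>\<sigma> n (S (v m))\<bar>" by (intro mult_left_mono) (auto simp: less_imp_le)
      ultimately show ?thesis by linarith
    qed (use Suc in simp)
  qed
  have S_id: "S x = x" for x
  proof -
    have "linear S" unfolding S_def[abs_def]
      using linear_compose[OF rho_linear[OF ig] T(1)] by (simp add: comp_def)
    have "\<sigma> n (S x) = \<sigma> n x" for n
      using S_eta[of n x] phi_S[of x] d_pos[of n] by (simp add: k)
    hence "S x - x = 0"
      using phi_S phi_linear sigma_linear by (intro total) (auto simp: linear_diff)
    thus ?thesis by simp
  qed
  have "T x = \<rho> (g 0) x" for x
    using S_id[of "\<rho> (g 0) x"] g ig by (simp add: S_def rho_mult[symmetric] rho_one)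
  thus ?thesis using g[of 0] by blast
qed

theorem isometry_group_iso: "isometry_group N \<cong> G"
proof -
  have rho_surj: "surj (\<rho> g)" if g: "g \<in> carrier G" for g
    using g rho_mult[of g "inv g"] by (intro surjI[of _ "\<rho> (inv g)"]) (simp add: rho_one)
  have inj: "inj_on \<rho> (carrier G)"
  proof (rule inj_onI)
    fix g h assume "g \<in> carrier G" "h \<in> carrier G" "\<rho> g = \<rho> h"
    moreover have "0 \<le> N x" for x using N_is_norm by (simp add: is_norm_def)
    ultimately show "g = h" by (intro eta_orbits_separated[of g h 0 0]) auto
  qed
  have "\<rho> \<in> hom G (isometry_group N)"
    using rho_linear rho_surj N_rho rho_mult by (auto simp: hom_def isometry_group_def fun_eq_iff)
  moreover have "\<rho> ` carrier G = carrier (isometry_group N)"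
  proof
    show "\<rho> ` carrier G \<subseteq> carrier (isometry_group N)"
      using rho_linear rho_surj N_rho by (auto simp: isometry_group_def)
    show "carrier (isometry_group N) \<subseteq> \<rho> ` carrier G"
    proof
      fix T assume "T \<in> carrier (isometry_group N)"
      thus "T \<in> \<rho> ` carrier G" using isometry_in_action[of T] by (auto simp: isometry_group_def)
    qed
  qed
  hence "bij_betw \<rho> (carrier G) (carrier (isometry_group N))"
    using inj by (simp add: bij_betw_def)
  ultimately have "\<rho> \<in> iso G (isometry_group N)" by (simp add: iso_def)
  hence "G \<cong> isometry_group N" by (auto simp: is_iso_def)
  thus ?thesis by (rule iso_sym)
qed

end

section \<open>Bounded actions by signed permutations\<close>

text \<open>
  Conjugation fixes the only nontrivial element of the subgroup.
\<close>
lemma (in group) normal_card_2_central_involution: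
  assumes H: "H \<lhd> G" "card H = 2"
  shows "\<exists>j\<in>carrier G. j \<noteq> \<one> \<and> j \<otimes> j = \<one> \<and> (\<forall>g\<in>carrier G. g \<otimes> j = j \<otimes> g)"
proof -
  have sub: "subgroup H G" using H(1) by (simp add: normal_def)
  have one: "\<one> \<in> H" using sub by (rule subgroup.one_closed)
  obtain a b where "H = {a, b}" "a \<noteq> b" using H(2) by (auto simp: card_2_iff)
  then obtain j where j: "H = {\<one>, j}" "j \<noteq> \<one>" using one by blast
  have jc: "j \<in> carrier G" using sub j subgroup.subset by blast
  have "j \<otimes> j \<in> H" using subgroup.m_closed[OF sub] j by simp
  moreover have "j \<otimes> j \<noteq> j" using jc j(2) by simp
  ultimately have jj: "j \<otimes> j = \<one>" using j by simp
  have "g \<otimes> j = j \<otimes> g" if g: "g \<in> carrier G" for g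
  proof -
    have "g \<otimes> j \<otimes> inv g \<in> H" using normal.inv_op_closed2[OF H(1) g, of j] j by simp
    moreover have "g \<otimes> j \<otimes> inv g \<noteq> \<one>"
    proof
      assume "g \<otimes> j \<otimes> inv g = \<one>"
      moreover have "g \<otimes> j = g \<otimes> j \<otimes> inv g \<otimes> g" using g jc by (simp add: m_assoc)
      ultimately have "g \<otimes> j = g" using g by simp
      thus False using g jc j(2) by simp
    qed
    ultimately have "g \<otimes> j \<otimes> inv g = j" using j by simp
    moreover have "g \<otimes> j = g \<otimes> j \<otimes> inv g \<otimes> g" using g jc by (simp add: m_assoc)
    ultimately show ?thesis by simp
  qed
  thus ?thesis using j jc jj by blast
qed

text \<open>
  A countable group with a central involution \<open>j\<close> acts on real sequences by signed permutations of
  the coordinates, freely up to sign, with \<open>j\<close> acting as minus the identity. The model is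
  the space of functions \<open>u\<close> on \<open>G \<times> nat\<close> that are odd, that is \<open>u (j g, k) = - u (g, k)\<close>, with
  \<open>(h u) (g, k) = u (g h, k)\<close>. Such a function is determined by its values on \<open>R \<times> nat\<close>, where \<open>R\<close>
  contains one of \<open>g\<close> and \<open>j g\<close> for each \<open>g\<close>, and a bijection \<open>\<beta>\<close> turns \<open>R \<times> nat\<close> into \<open>nat\<close>. The
  conclusions are those of the resulting action \<open>(g x) n = \<epsilon> g n * x (\<pi> g n)\<close>.
\<close>
lemma (in group) signed_permutation_action:
  assumes cnt: "countable (carrier G)" and j: "j \<in> carrier G" "j \<noteq> \<one>" "j \<otimes> j = \<one>"
    and central: "\<And>g. g \<in> carrier G \<Longrightarrow> g \<otimes> j = j \<otimes> g"
  obtains \<epsilon> :: "'a \<Rightarrow> nat \<Rightarrow> real" and \<pi> :: "'a \<Rightarrow> nat \<Rightarrow> nat"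
  where "\<And>g n. \<bar>\<epsilon> g n\<bar> = 1" "\<And>g. g \<in> carrier G \<Longrightarrow> bij (\<pi> g)"
    "\<And>g h n. g \<in> carrier G \<Longrightarrow> h \<in> carrier G \<Longrightarrow> \<pi> (g \<otimes> h) n = \<pi> h (\<pi> g n)"
    "\<And>g h n. g \<in> carrier G \<Longrightarrow> h \<in> carrier G \<Longrightarrow> \<epsilon> (g \<otimes> h) n = \<epsilon> g n * \<epsilon> h (\<pi> g n)"
    "\<And>n. \<pi> \<one> n = n" "\<And>n. \<epsilon> \<one> n = 1" "\<And>n. \<pi> j n = n" "\<And>n. \<epsilon> j n = -1"
    "\<And>g n. g \<in> carrier G \<Longrightarrow> \<pi> g n = n \<Longrightarrow> g = \<one> \<or> g = j"
proof -
  have jj: "j \<otimes> (j \<otimes> g) = g" if "g \<in> carrier G" for g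
    using that j by (simp add: m_assoc[symmetric])
  have jne: "j \<otimes> g \<noteq> g" if "g \<in> carrier G" for g
    using that j by simp
  define pick where "pick P = (SOME x. x \<in> P)" for P :: "'a set"
  define R where "R = {g \<in> carrier G. pick {g, j \<otimes> g} = g}"
  have R: "(j \<otimes> g \<in> R) = (g \<notin> R)" if g: "g \<in> carrier G" for g
  proof -
    have "{j \<otimes> g, j \<otimes> (j \<otimes> g)} = {g, j \<otimes> g}" using jj[OF g] by auto
    moreover have "pick {g, j \<otimes> g} \<in> {g, j \<otimes> g}" unfolding pick_def by (rule someI[of _ g]) simp
    ultimately show ?thesis using g j(1) jne[OF g] by (auto simp: R_def)
  qed
  define rep where "rep g = (if g \<in> R then g else j \<otimes> g)" for g
  define sg where "sg g = (if g \<in> R then 1 else -1 :: real)" for g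
  have R_carrier: "r \<in> R \<Longrightarrow> r \<in> carrier G" for r by (simp add: R_def)
  have rep_R: "rep g \<in> R" if "g \<in> carrier G" for g using R[OF that] by (simp add: rep_def)
  have rep_id: "rep g = g" if "g \<in> R" for g using that by (simp add: rep_def)
  have rep_j: "rep (j \<otimes> g) = rep g" and sg_j: "sg (j \<otimes> g) = - sg g" if "g \<in> carrier G" for g
    using R[OF that] jj[OF that] by (auto simp: rep_def sg_def)
  have rep_mult: "rep (rep g \<otimes> h) = rep (g \<otimes> h)" and sg_mult: "sg (rep g \<otimes> h) = sg g * sg (g \<otimes> h)"
    if g: "g \<in> carrier G" and h: "h \<in> carrier G" for g h
  proof -
    have "j \<otimes> g \<otimes> h = j \<otimes> (g \<otimes> h)" using g h j(1) by (simp add: m_assoc)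
    thus "rep (rep g \<otimes> h) = rep (g \<otimes> h)" "sg (rep g \<otimes> h) = sg g * sg (g \<otimes> h)"
      using rep_j[of "g \<otimes> h"] sg_j[of "g \<otimes> h"] g h by (auto simp: rep_def[of g] sg_def[of g])
  qed
  have "R \<noteq> {}" using rep_R[of \<one>] by auto
  hence inf: "infinite (R \<times> (UNIV :: nat set))" by (simp add: finite_cartesian_product_iff)
  have "countable R" using cnt R_carrier by (meson countable_subset subsetI)
  hence "countable (R \<times> (UNIV :: nat set))" by simp
  then obtain \<beta> where \<beta>: "bij_betw \<beta> (R \<times> (UNIV :: nat set)) (UNIV :: nat set)"
    using inf to_nat_on_infinite by blast
  define \<alpha> where "\<alpha> = inv_into (R \<times> (UNIV :: nat set)) \<beta>"
  have ba: "\<beta> (\<alpha> n) = n" for n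
    unfolding \<alpha>_def using \<beta> by (intro f_inv_into_f) (auto simp: bij_betw_def)
  have ab: "\<alpha> (\<beta> (r, k)) = (r, k)" if "r \<in> R" for r k
    unfolding \<alpha>_def using \<beta> that by (intro inv_into_f_f) (auto simp: bij_betw_def)
  have aR: "fst (\<alpha> n) \<in> R" for n
  proof -
    have "\<alpha> n \<in> R \<times> UNIV" unfolding \<alpha>_def using \<beta> by (intro inv_into_into) (auto simp: bij_betw_def)
    thus ?thesis by auto
  qed
  hence aG: "fst (\<alpha> n) \<in> carrier G" for n using R_carrier by blast
  define \<pi> where "\<pi> h n = \<beta> (rep (fst (\<alpha> n) \<otimes> h), snd (\<alpha> n))" for h n
  define \<epsilon> where "\<epsilon> h n = sg (fst (\<alpha> n) \<otimes> h)" for h n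
  have a_pi: "\<alpha> (\<pi> h n) = (rep (fst (\<alpha> n) \<otimes> h), snd (\<alpha> n))" if "h \<in> carrier G" for h n
    unfolding \<pi>_def using that aG by (intro ab rep_R) simp
  have pi_mult: "\<pi> (g \<otimes> h) n = \<pi> h (\<pi> g n)" if "g \<in> carrier G" "h \<in> carrier G" for g h n
    unfolding \<pi>_def[of h] \<pi>_def[of "g \<otimes> h"] a_pi[OF that(1)] using that aG
    by (simp add: rep_mult m_assoc)
  have pi_one: "\<pi> \<one> n = n" for n
    using aG aR by (simp add: \<pi>_def rep_id ba)
  have r_j: "fst (\<alpha> n) \<otimes> j = j \<otimes> fst (\<alpha> n)" for n using central[OF aG] .
  show ?thesis
  proof (rule that[of \<epsilon> \<pi>])
    show "\<bar>\<epsilon> g n\<bar> = 1" for g n by (simp add: \<epsilon>_def sg_def)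
    show "bij (\<pi> g)" if g: "g \<in> carrier G" for g
    proof (rule bijI')
      show "(\<pi> g x = \<pi> g y) = (x = y)" for x y
      proof
        assume "\<pi> g x = \<pi> g y"
        hence "\<pi> (inv g) (\<pi> g x) = \<pi> (inv g) (\<pi> g y)" by simp
        thus "x = y" using g by (simp add: pi_mult[symmetric] pi_one)
      qed simp
      show "\<exists>x. y = \<pi> g x" for y
        using g by (intro exI[of _ "\<pi> (inv g) y"]) (simp add: pi_mult[symmetric] pi_one)
    qed
    show "\<pi> (g \<otimes> h) n = \<pi> h (\<pi> g n)" if "g \<in> carrier G" "h \<in> carrier G" for g h n
      using that by (rule pi_mult)
    show "\<epsilon> (g \<otimes> h) n = \<epsilon> g n * \<epsilon> h (\<pi> g n)" if "g \<in> carrier G" "h \<in> carrier G" for g h n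
    proof -
      have "sg a * (sg a * b) = b" for a b by (simp add: sg_def)
      thus ?thesis unfolding \<epsilon>_def a_pi[OF that(1)] fst_conv using that aG
        by (simp add: sg_mult m_assoc)
    qed
    show "\<pi> \<one> n = n" for n by (rule pi_one)
    show "\<epsilon> \<one> n = 1" for n using aG aR by (simp add: \<epsilon>_def sg_def)
    show "\<pi> j n = n" for n using aG aR by (simp add: \<pi>_def r_j rep_j rep_id ba)
    show "\<epsilon> j n = -1" for n using aG aR by (simp add: \<epsilon>_def r_j sg_j) (simp add: sg_def)
    show "g = \<one> \<or> g = j" if g: "g \<in> carrier G" and fix_n: "\<pi> g n = n" for g n
    proof -
      let ?r = "fst (\<alpha> n)"
      have "rep (?r \<otimes> g) = ?r" using a_pi[OF g, of n] fix_n by (metis fst_conv)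
      hence "?r \<otimes> g = ?r \<or> j \<otimes> (?r \<otimes> g) = ?r" by (auto simp: rep_def split: if_splits)
      thus ?thesis
      proof
        assume "?r \<otimes> g = ?r" thus ?thesis using aG[of n] g by simp
      next
        assume "j \<otimes> (?r \<otimes> g) = ?r"
        hence "?r \<otimes> g = j \<otimes> ?r" using jj[of "?r \<otimes> g"] aG[of n] g by simp
        hence "?r \<otimes> g = ?r \<otimes> j" by (simp add: r_j)
        thus ?thesis using aG[of n] g j(1) by simp
      qed
    qed
  qed
qed

text \<open>
  The supremum of the norm over the orbit.
\<close>
lemma (in group) bounded_action_invariant_norm:
  fixes \<rho> :: "'a \<Rightarrow> 'x::real_normed_vector \<Rightarrow> 'x"
  assumes lin: "\<And>g. g \<in> carrier G \<Longrightarrow> linear (\<rho> g)"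
    and one: "\<And>x. \<rho> \<one> x = x"
    and mult: "\<And>g h x. g \<in> carrier G \<Longrightarrow> h \<in> carrier G \<Longrightarrow> \<rho> (g \<otimes> h) x = \<rho> g (\<rho> h x)"
    and bound: "\<And>g x. g \<in> carrier G \<Longrightarrow> norm (\<rho> g x) \<le> L * norm x"
  obtains p where "is_norm p" "\<And>g x. g \<in> carrier G \<Longrightarrow> p (\<rho> g x) = p x"
    "\<And>x. norm x \<le> p x" "\<And>x. p x \<le> L * norm x"
proof -
  define p where "p x = (SUP g\<in>carrier G. norm (\<rho> g x))" for x
  have le: "norm (\<rho> g x) \<le> p x" if "g \<in> carrier G" for g x
    unfolding p_def using that bound by (intro cSUP_upper bdd_aboveI2[of _ _ "L * norm x"]) auto
  have least: "p x \<le> c" if "\<And>g. g \<in> carrier G \<Longrightarrow> norm (\<rho> g x) \<le> c" for x c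
    unfolding p_def by (rule cSUP_least) (use that in auto)
  have norm_le: "norm x \<le> p x" for x using le[of \<one> x] by (simp add: one)
  have p_rho_le: "p (\<rho> h x) \<le> p x" if "h \<in> carrier G" for h x
    by (rule least) (metis le m_closed mult that)
  have scale_le: "p (a *\<^sub>R x) \<le> \<bar>a\<bar> * p x" for a x
    by (rule least) (use lin le in \<open>simp add: linear_scale mult_left_mono\<close>)
  show ?thesis
  proof (rule that[of p])
    show "norm x \<le> p x" for x by (rule norm_le)
    show upper: "p x \<le> L * norm x" for x by (rule least) (rule bound)
    show "p (\<rho> g x) = p x" if g: "g \<in> carrier G" for g x
    proof (rule antisym)
      have "\<rho> (inv g) (\<rho> g x) = x" using g by (simp add: mult[symmetric] one)
      thus "p x \<le> p (\<rho> g x)" using p_rho_le[of "inv g" "\<rho> g x"] g by simp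
    qed (rule p_rho_le[OF g])
    show "is_norm p"
      unfolding is_norm_def
    proof (intro conjI allI)
      fix x y :: 'x and a :: real
      show "0 \<le> p x" using norm_le[of x] norm_ge_zero[of x] by linarith
      show "p x = 0 \<longleftrightarrow> x = 0"
      proof
        assume "p x = 0" thus "x = 0" using norm_le[of x] by simp
      next
        assume "x = 0" thus "p x = 0" using upper[of 0] norm_le[of 0] by simp
      qed
      show "p (x + y) \<le> p x + p y"
      proof (rule least)
        fix g assume g: "g \<in> carrier G"
        have "norm (\<rho> g (x + y)) \<le> norm (\<rho> g x) + norm (\<rho> g y)"
          using lin[OF g] by (simp add: linear_add norm_triangle_ineq)
        thus "norm (\<rho> g (x + y)) \<le> p x + p y" using le[OF g, of x] le[OF g, of y] by linarith
      qed
      show "p (a *\<^sub>R x) = \<bar>a\<bar> * p x"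
      proof (cases "a = 0")
        case True thus ?thesis using upper[of 0] norm_le[of 0] by simp
      next
        case False
        have "p (inverse a *\<^sub>R (a *\<^sub>R x)) \<le> \<bar>inverse a\<bar> * p (a *\<^sub>R x)" by (rule scale_le)
        hence "\<bar>a\<bar> * p x \<le> p (a *\<^sub>R x)" using False by (simp add: field_simps)
        thus ?thesis using scale_le[of a x] by simp
      qed
    qed
  qed
qed

section \<open>Representability\<close>

theorem theorem14:
  fixes G :: "('g, 'm) monoid_scheme"
  assumes "group G"
    and "countable (carrier G)"
    and "\<exists>H. H \<lhd> G \<and> card H = 2"
    and "infinite_dimensional TYPE('x::{banach, second_countable_topology})"
    and "separable_space (euclidean :: 'x topology)"
    and "symmetric_decomposition TYPE('x) TYPE('y::banach) TYPE('s::banach)"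
    and "isomorphic_to_seq_space TYPE('x) (c0_space :: (nat \<Rightarrow> 'z::banach) set) c0_norm
       \<or> (\<exists>p\<ge>1. isomorphic_to_seq_space TYPE('x) (lp_space p :: (nat \<Rightarrow> 'z) set) (lp_norm p))
       \<or> radon_nikodym_property TYPE('x)"
  shows "representable_in G TYPE('x)"
proof -
  interpret group G by fact
  obtain j where j: "j \<in> carrier G" "j \<noteq> \<one>\<^bsub>G\<^esub>" "j \<otimes>\<^bsub>G\<^esub> j = \<one>\<^bsub>G\<^esub>"
    "\<And>g. g \<in> carrier G \<Longrightarrow> g \<otimes>\<^bsub>G\<^esub> j = j \<otimes>\<^bsub>G\<^esub> g"
    using normal_card_2_central_involution assms(3) by blast
  obtain \<epsilon> :: "'g \<Rightarrow> nat \<Rightarrow> real" and \<pi> :: "'g \<Rightarrow> nat \<Rightarrow> nat" where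
    eps: "\<And>g n. \<bar>\<epsilon> g n\<bar> = 1" and pi_bij: "\<And>g. g \<in> carrier G \<Longrightarrow> bij (\<pi> g)"
    and pi_mult: "\<And>g h n. g \<in> carrier G \<Longrightarrow> h \<in> carrier G \<Longrightarrow> \<pi> (g \<otimes>\<^bsub>G\<^esub> h) n = \<pi> h (\<pi> g n)"
    and eps_mult: "\<And>g h n. g \<in> carrier G \<Longrightarrow> h \<in> carrier G \<Longrightarrow> \<epsilon> (g \<otimes>\<^bsub>G\<^esub> h) n = \<epsilon> g n * \<epsilon> h (\<pi> g n)"
    and pi_one: "\<And>n. \<pi> \<one>\<^bsub>G\<^esub> n = n" and eps_one: "\<And>n. \<epsilon> \<one>\<^bsub>G\<^esub> n = 1"
    and pi_j: "\<And>n. \<pi> j n = n" and eps_j: "\<And>n. \<epsilon> j n = -1"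
    and pi_free: "\<And>g n. g \<in> carrier G \<Longrightarrow> \<pi> g n = n \<Longrightarrow> g = \<one>\<^bsub>G\<^esub> \<or> g = j"
    using signed_permutation_action[OF assms(2) j] by blast
  have pi_fibre: "finite {g \<in> carrier G. \<pi> g n \<in> A}" if A: "finite A" for n A
  proof -
    have "finite {g \<in> carrier G. \<pi> g n = m}" for m
    proof (cases "\<exists>h\<in>carrier G. \<pi> h n = m")
      case True
      then obtain h where h: "h \<in> carrier G" "\<pi> h n = m" by blast
      have "g \<in> {h, j \<otimes>\<^bsub>G\<^esub> h}" if g: "g \<in> carrier G" "\<pi> g n = m" for g
      proof -
        have ih: "inv\<^bsub>G\<^esub> h \<in> carrier G" using h by simp
        have "\<pi> (g \<otimes>\<^bsub>G\<^esub> inv\<^bsub>G\<^esub> h) n = \<pi> (h \<otimes>\<^bsub>G\<^esub> inv\<^bsub>G\<^esub> h) n"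
          unfolding pi_mult[OF g(1) ih] pi_mult[OF h(1) ih] using g h by simp
        hence "\<pi> (g \<otimes>\<^bsub>G\<^esub> inv\<^bsub>G\<^esub> h) n = n" using h by (simp add: pi_one)
        hence "g \<otimes>\<^bsub>G\<^esub> inv\<^bsub>G\<^esub> h = \<one>\<^bsub>G\<^esub> \<or> g \<otimes>\<^bsub>G\<^esub> inv\<^bsub>G\<^esub> h = j" using pi_free g ih by simp
        moreover have "g = g \<otimes>\<^bsub>G\<^esub> inv\<^bsub>G\<^esub> h \<otimes>\<^bsub>G\<^esub> h" using g h by (simp add: m_assoc)
        ultimately show ?thesis using h by auto
      qed
      hence "{g \<in> carrier G. \<pi> g n = m} \<subseteq> {h, j \<otimes>\<^bsub>G\<^esub> h}" by blast
      thus ?thesis by (rule finite_subset) simp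
    next
      case False
      hence empty: "{g \<in> carrier G. \<pi> g n = m} = {}" by blast
      show ?thesis unfolding empty by simp
    qed
    hence "finite (\<Union>m\<in>A. {g \<in> carrier G. \<pi> g n = m})" using A by blast
    moreover have "{g \<in> carrier G. \<pi> g n \<in> A} = (\<Union>m\<in>A. {g \<in> carrier G. \<pi> g n = m})" by blast
    ultimately show ?thesis by simp
  qed
  obtain s :: "nat \<Rightarrow> 's" and T :: "'x \<Rightarrow> nat \<Rightarrow> 'y" where s: "symmetric_basis s"
    and T_linear: "\<And>n. linear (\<lambda>x. T x n)" and T_bij: "bij_betw T UNIV (sum_space s)"
    and T_norm: "\<And>x. sum_norm s (T x) = norm x"
    using assms(6) unfolding symmetric_decomposition_def isometric_to_seq_space_def by blast
  have T_in: "summable (\<lambda>n. norm (T x n) *\<^sub>R s n)" for x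
    using T_bij unfolding bij_betw_def sum_space_def by blast
  have T_inj: "x = x'" if "\<And>n. T x n = T x' n" for x x'
  proof -
    have "T x = T x'" using that by blast
    thus ?thesis using T_bij by (meson UNIV_I bij_betw_def inj_onD)
  qed
  have T_surj: "\<exists>x. T x = y" if "summable (\<lambda>n. norm (y n) *\<^sub>R s n)" for y
  proof -
    have "y \<in> range T" using that T_bij by (simp add: bij_betw_def sum_space_def)
    thus ?thesis by blast
  qed
  obtain L where L': "L > 0 \<and> (\<forall>a \<pi>. bij \<pi> \<longrightarrow> summable (\<lambda>n. a n *\<^sub>R s n) \<longrightarrow>
      summable (\<lambda>n. a (\<pi> n) *\<^sub>R s n) \<and>
      norm (\<Sum>n. a (\<pi> n) *\<^sub>R s n) \<le> L * norm (\<Sum>n. a n *\<^sub>R s n))"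
    using symmetric_basis_rearrangement[OF s] by (rule exE)
  have L: "summable (\<lambda>n. a (\<pi> n) *\<^sub>R s n)"
    "norm (\<Sum>n. a (\<pi> n) *\<^sub>R s n) \<le> L * norm (\<Sum>n. a n *\<^sub>R s n)"
    if "bij \<pi>" "summable (\<lambda>n. a n *\<^sub>R s n)" for a \<pi>
    using conjunct2[OF L', rule_format, OF that] L' by simp_all
  have L0: "L > 0" using L' by simp
  obtain C where C': "C > 0 \<and> (\<forall>a. summable (\<lambda>n. a n *\<^sub>R s n) \<longrightarrow>
     (\<forall>i. \<bar>a i\<bar> \<le> C * norm (\<Sum>n. a n *\<^sub>R s n)) \<and> a \<longlonglongrightarrow> 0)"
    using symmetric_basis_coeff_bound[OF s] by (rule exE)
  have C: "C > 0" using C' by simp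
  have C_le: "\<bar>a i\<bar> \<le> C * norm (\<Sum>n. a n *\<^sub>R s n)" and C_null: "a \<longlonglongrightarrow> 0"
    if "summable (\<lambda>n. a n *\<^sub>R s n)" for a i
    using conjunct2[OF C', rule_format, OF that] by simp_all
  have T_coord: "norm (T x n) \<le> C * norm x" for x n
    using C_le[OF T_in[of x], of n] T_norm[of x] by (simp add: sum_norm_def)
  have T_null: "(\<lambda>n. norm (T x n)) \<longlonglongrightarrow> 0" for x by (rule C_null[OF T_in])

  \<comment> \<open>The group permutes and changes the signs of the coordinates in the decomposition. Signs do
    not affect the norms of coordinates, and permutations are uniformly bounded.\<close>
  define \<rho> where "\<rho> g x = (SOME x'. \<forall>n. T x' n = \<epsilon> g n *\<^sub>R T x (\<pi> g n))" for g x
  have eps_norm: "norm (\<epsilon> g n *\<^sub>R y) = norm y" for g n and y :: 'y using eps by simp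
  have T_rho: "T (\<rho> g x) n = \<epsilon> g n *\<^sub>R T x (\<pi> g n)" if g: "g \<in> carrier G" for g x n
  proof -
    have "summable (\<lambda>n. norm (\<epsilon> g n *\<^sub>R T x (\<pi> g n)) *\<^sub>R s n)"
      unfolding eps_norm by (rule L(1)[OF pi_bij[OF g] T_in])
    then obtain x' where "T x' = (\<lambda>n. \<epsilon> g n *\<^sub>R T x (\<pi> g n))" by (rule T_surj[THEN exE])
    hence "\<exists>x'. \<forall>n. T x' n = \<epsilon> g n *\<^sub>R T x (\<pi> g n)" by (intro exI[of _ x']) simp
    from someI_ex[OF this] show ?thesis unfolding \<rho>_def by blast
  qed
  have rho_linear: "linear (\<rho> g)" if g: "g \<in> carrier G" for g
  proof (rule linearI)
    show "\<rho> g (x + y) = \<rho> g x + \<rho> g y" for x y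
      by (rule T_inj) (simp add: T_rho[OF g] linear_add[OF T_linear] scaleR_add_right)
    show "\<rho> g (c *\<^sub>R x) = c *\<^sub>R \<rho> g x" for c x
      by (rule T_inj) (simp add: T_rho[OF g] linear_scale[OF T_linear] mult.commute)
  qed
  have rho_one: "\<rho> \<one>\<^bsub>G\<^esub> x = x" for x by (rule T_inj) (simp add: T_rho pi_one eps_one)
  have rho_j: "\<rho> j x = - x" for x
    by (rule T_inj) (simp add: T_rho[OF j(1)] pi_j eps_j linear_neg[OF T_linear])
  have rho_mult: "\<rho> (g \<otimes>\<^bsub>G\<^esub> h) x = \<rho> g (\<rho> h x)" if "g \<in> carrier G" "h \<in> carrier G" for g h x
    by (rule T_inj) (use that in \<open>simp add: T_rho pi_mult eps_mult\<close>)
  have rho_norm: "norm (\<rho> g x) \<le> L * norm x" if g: "g \<in> carrier G" for g x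
  proof -
    have "norm (\<rho> g x) = norm (\<Sum>n. norm (T x (\<pi> g n)) *\<^sub>R s n)"
      unfolding T_norm[symmetric] sum_norm_def by (simp only: T_rho[OF g] eps_norm)
    also have "\<dots> \<le> L * norm x"
      using L(2)[OF pi_bij[OF g] T_in[of x]] T_norm[of x] by (simp add: sum_norm_def)
    finally show ?thesis .
  qed
  obtain p0 where p0: "is_norm p0" "\<And>g x. g \<in> carrier G \<Longrightarrow> p0 (\<rho> g x) = p0 x"
    "\<And>x. norm x \<le> p0 x" "\<And>x. p0 x \<le> L * norm x"
    using bounded_action_invariant_norm[of \<rho> L] rho_linear rho_one rho_mult rho_norm by blast

  obtain y0 :: 'y where y0: "y0 \<noteq> 0"
  proof -
    have "\<exists>x :: 'x. x \<noteq> 0"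
    proof (rule ccontr)
      assume "\<not> ?thesis"
      hence "span {} = (UNIV :: 'x set)" by auto
      thus False using assms(4) unfolding infinite_dimensional_def by blast
    qed
    then obtain x :: 'x where "x \<noteq> 0" by blast
    hence "\<exists>n. T x n \<noteq> T 0 n" using T_inj by blast
    thus ?thesis using that linear_0[OF T_linear] by metis
  qed
  obtain f1 where f1: "linear f1" "\<And>y. \<bar>f1 y\<bar> \<le> norm y" "f1 y0 = norm y0"
    using norming_functional[of y0] by blast
  define f where "f y = inverse (norm y0) *\<^sub>R f1 y" for y
  define F where "F = inverse (norm y0)"
  have F: "F > 0" using y0 by (simp add: F_def)
  have f_linear: "linear f" unfolding f_def[abs_def] using f1(1) by (rule linear_compose_scale_right)
  have f_le: "\<bar>f y\<bar> \<le> F * norm y" for y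
    using f1(2)[of y] F by (simp add: f_def F_def abs_mult)
  have f_y0: "f y0 = 1" using f1(3) y0 by (simp add: f_def)
  have "\<exists>x. \<forall>n. T x n = (if n = i then y0 else 0)" for i
  proof -
    have "summable (\<lambda>n. norm (if n = i then y0 else 0) *\<^sub>R s n)"
      by (rule summable_finite[of "{i}"]) auto
    then  obtain x where "T x = (\<lambda>n. if n = i then y0 else 0)"
      by (rule T_surj[THEN exE])
    thus ?thesis by (intro exI[of _ x]) simp
  qed
  then obtain unit where unit: "\<And>i n. T (unit i) n = (if n = i then y0 else 0)" by metis
  define \<phi> where "\<phi> x = f (T x 0)" for x
  \<comment> \<open>\<open>z\<close> and \<open>\<phi>\<close> live on the coordinate 0, \<open>\<psi>\<close> on a different one.\<close>
  define \<psi> where "\<psi> x = f (T x (Suc 0))" for x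
  define z where "z = unit 0"
  have phi_linear: "linear \<phi>" and psi_linear: "linear \<psi>"
    unfolding \<phi>_def[abs_def] \<psi>_def[abs_def]
    using linear_compose[OF T_linear f_linear] by (simp_all add: comp_def)
  have phi_z: "\<phi> z = 1" and psi_z: "\<psi> z = 0" and psi_unit: "\<psi> (unit (Suc 0)) = 1"
    using f_y0 linear_0[OF f_linear] by (simp_all add: \<phi>_def \<psi>_def z_def unit)
  have coord_le: "\<bar>f (T x n)\<bar> \<le> F * C * norm x" for x n
  proof -
    have "\<bar>f (T x n)\<bar> \<le> F * norm (T x n)" by (rule f_le)
    also have "\<dots> \<le> F * (C * norm x)" using F T_coord by (intro mult_left_mono) auto
    finally show ?thesis by (simp add: mult.assoc)
  qed
  have vanish: "finite {g \<in> carrier G. e \<le> \<bar>f (T (\<rho> g x) n)\<bar>}" if e: "e > 0" for e x n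
  proof -
    obtain n0 where n0: "\<And>m. m \<ge> n0 \<Longrightarrow> norm (T x m) < e / F"
      using order_tendstoD(2)[OF T_null[of x], of "e / F"] e F by (auto simp: eventually_sequentially)
    have "\<pi> g n \<in> {..<n0}" if g: "g \<in> carrier G" "e \<le> \<bar>f (T (\<rho> g x) n)\<bar>" for g
    proof (rule ccontr)
      assume "\<not> ?thesis"
      hence "norm (T x (\<pi> g n)) < e / F" using n0 by simp
      hence "F * norm (T x (\<pi> g n)) < e" using F by (simp add: field_simps)
      moreover have "\<bar>f (T (\<rho> g x) n)\<bar> \<le> F * norm (T x (\<pi> g n))"
        using f_le[of "T (\<rho> g x) n"] by (simp add: T_rho[OF g(1)] eps)
      ultimately show False using g(2) by linarith
    qed
    hence "{g \<in> carrier G. e \<le> \<bar>f (T (\<rho> g x) n)\<bar>} \<subseteq> {g \<in> carrier G. \<pi> g n \<in> {..<n0}}" by blast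
    thus ?thesis by (rule finite_subset) (rule pi_fibre, simp)
  qed

  \<comment> \<open>The invariant norm is scaled down so that \<open>z\<close> has norm at most 1/4.\<close>
  define c where "c = 1 / (4 * (p0 z + 1))"
  have p0z: "p0 z \<ge> 0" using p0(1) by (simp add: is_norm_def)
  have c: "c > 0" using p0z by (simp add: c_def)
  define p where "p x = c * p0 x" for x
  have p_norm: "is_norm p" using p0(1) c by (auto simp: p_def is_norm_def distrib_left[symmetric])
  have p_z: "p z \<le> 1/4" using p0z by (simp add: p_def c_def field_simps)
  have p_ge: "c * norm x \<le> p x" and p_le: "p x \<le> c * L * norm x" for x
    using p0(3,4) c by (simp_all add: p_def mult.assoc)
  define R where "R = F * C / c"
  have R: "R > 0" using F C c by (simp add: R_def)
  have coord_le_p: "\<bar>f (T x n)\<bar> \<le> R * p x" for x n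
  proof -
    have "F * C * norm x \<le> F * C * p0 x" using p0(3) F C by (intro mult_left_mono) auto
    also have "\<dots> = R * p x" using c by (simp add: R_def p_def)
    finally show ?thesis using coord_le[of x n] by linarith
  qed

  obtain h :: "nat \<Rightarrow> 'x \<Rightarrow> real" where h: "\<And>n. linear (h n)" "\<And>n x. \<bar>h n x\<bar> \<le> norm x"
    "\<And>x. (\<And>n. h n x = 0) \<Longrightarrow> x = 0"
    using total_sequence_of_functionals by blast
  \<comment> \<open>The functional \<open>\<psi>\<close> comes first because it tends to zero along orbits; the others are made
    to vanish at \<open>z\<close>.\<close>
  define \<tau> where "\<tau> n = (case n of 0 \<Rightarrow> \<psi> | Suc m \<Rightarrow> (\<lambda>x. h m x - h m z *\<^sub>R \<phi> x))" for n
  define B where "B n = (case n of 0 \<Rightarrow> R | Suc m \<Rightarrow> 1 / c + \<bar>h m z\<bar> * R)" for n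
  obtain \<sigma> :: "nat \<Rightarrow> 'x \<Rightarrow> real" and v where sigma:
    "\<And>n. linear (\<sigma> n)" "\<And>n x. \<bar>\<sigma> n x\<bar> \<le> p x" "\<And>n. \<sigma> n z = 0"
    "\<And>n. \<phi> (v n) = 0" "\<And>n. \<sigma> n (v n) = 1" "\<And>m n. m < n \<Longrightarrow> \<sigma> m (v n) = 0"
    "\<And>x. \<phi> x = 0 \<Longrightarrow> (\<And>n. \<sigma> n x = 0) \<Longrightarrow> x = 0" "\<And>x. \<sigma> 0 x = \<tau> 0 x / B 0"
  proof (rule triangular_subsystem[OF assms(4) phi_linear phi_z, of \<tau> "unit (Suc 0)" B p])
    show "linear (\<tau> n)" for n
    proof (cases n)
      case (Suc m)
      show ?thesis unfolding Suc \<tau>_def nat.case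
        by (intro linear_compose_sub linear_compose_scale_right h phi_linear)
    qed (use psi_linear in \<open>simp add: \<tau>_def\<close>)
    show "\<tau> n z = 0" for n by (cases n) (simp_all add: \<tau>_def psi_z phi_z)
    show "\<tau> 0 (unit (Suc 0)) \<noteq> 0" by (simp add: \<tau>_def psi_unit)
    show "B n > 0" for n using R c by (cases n) (auto simp: B_def intro!: add_pos_nonneg)
    show "\<bar>\<tau> n x\<bar> \<le> B n * p x" for n x
    proof (cases n)
      case 0 thus ?thesis using coord_le_p[of x "Suc 0"] by (simp add: \<tau>_def B_def \<psi>_def)
    next
      case (Suc m)
      have "\<bar>h m x\<bar> \<le> 1 / c * p x" using h(2)[of m x] p0(3)[of x] c by (simp add: p_def)
      moreover have "\<bar>h m z * \<phi> x\<bar> \<le> \<bar>h m z\<bar> * (R * p x)"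
        unfolding abs_mult \<phi>_def by (intro mult_left_mono coord_le_p) simp
      ultimately show ?thesis by (simp add: Suc \<tau>_def B_def distrib_right)
    qed
    show "x = 0" if "\<phi> x = 0" "\<And>n. \<tau> n x = 0" for x
      using that(1) that(2)[of "Suc _"] by (intro h(3)) (simp add: \<tau>_def)
  qed blast

  interpret S: signed_action G j \<rho> p R \<phi> \<sigma> z v
  proof (intro signed_action.intro signed_action_axioms.intro)
    show "group G" "j \<in> carrier G" by fact+
    show "linear (\<rho> g)" if "g \<in> carrier G" for g using that by (rule rho_linear)
    show "p (\<rho> g x) = p x" if "g \<in> carrier G" for g x using that p0(2) by (simp add: p_def)
    show "\<rho> (g \<otimes>\<^bsub>G\<^esub> h) x = \<rho> g (\<rho> h x)" if "g \<in> carrier G" "h \<in> carrier G" for g h x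
      using that by (rule rho_mult)
    show "\<phi> (\<rho> g z) = 0" if g: "g \<in> carrier G" "g \<noteq> \<one>\<^bsub>G\<^esub>" "g \<noteq> j" for g
      using pi_free[OF g(1), of 0] g linear_0[OF f_linear] by (auto simp: \<phi>_def T_rho z_def unit)
    show "\<bar>\<phi> x\<bar> \<le> R * p x" for x unfolding \<phi>_def by (rule coord_le_p)
    show "finite {g \<in> carrier G. e \<le> \<bar>\<phi> (\<rho> g x)\<bar>}" if "e > 0" for e x
      unfolding \<phi>_def using that by (rule vanish)
    show "finite {g \<in> carrier G. e \<le> \<bar>\<sigma> 0 (\<rho> g x)\<bar>}" if e: "e > 0" for e x
    proof -
      have "\<sigma> 0 y = f (T y (Suc 0)) / R" for y by (simp add: sigma(8) \<tau>_def B_def \<psi>_def)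
      hence "{g \<in> carrier G. e \<le> \<bar>\<sigma> 0 (\<rho> g x)\<bar>} = {g \<in> carrier G. e * R \<le> \<bar>f (T (\<rho> g x) (Suc 0))\<bar>}"
        using R by (simp add: abs_divide pos_le_divide_eq)
      thus ?thesis using vanish[of "e * R" x "Suc 0"] e R by simp
    qed
  qed (use rho_one rho_j p_norm R phi_linear phi_z p_z sigma in auto)

  have "is_equivalent_norm S.N"
    unfolding is_equivalent_norm_def
  proof (intro conjI exI allI)
    show "is_norm S.N" by (rule S.N_is_norm)
    show "c > 0" by fact
    show "(R + 2) * (c * L) > 0" using R c L0 by simp
    fix x
    show "c * norm x \<le> S.N x" using p_ge[of x] S.p_le_N[of x] by linarith
    have "S.N x \<le> (R + 2) * p x" by (rule S.N_le_p)
    also have "\<dots> \<le> (R + 2) * (c * L * norm x)" using p_le R by (intro mult_left_mono) auto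
    finally show "S.N x \<le> (R + 2) * (c * L) * norm x" by (simp add: mult.assoc)
  qed
  thus ?thesis unfolding representable_in_def using S.isometry_group_iso by blast
qed

end
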